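(* Let $d\ge3$, $1\le k\le d$, $A=\{x\in\mathbb Z^d:x_1\ge1,\dots,x_k\ge1\}$, $o\in A$, $q>1$, and $\alpha\ge0$. Then the following are equivalent: (i) there is $C>0$ such that $\sum_{y\in A}G_A(x,y)\,|y|^{-\alpha}\,G_A(o,y)^q\le C\,G_A(o,x)$ for all $x\in A$; (ii) $\alpha+q(d+k-2)>d+k$, i.e. $q>\frac{d+k-\alpha}{d+k-2}$.
   Context: $\mathbb Z^d$ carries unit weights on nearest-neighbour edges, so $\mu(x)=2d$. $G_A(x,y)=\frac1{2d}\sum_{n\ge0}\mathbb P_x(S_n=y,\ n<\tau_{A^c})$ is the Dirichlet Green function of $A$, where $(S_n)$ is simple random walk and $\tau_{A^c}$ its first hitting time of $\mathbb Z^d\setminus A$. $|\cdot|$ is the Euclidean norm. *)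

theory Defs
  imports "HOL-Analysis.Analysis"
begin

text \<open>Points of Z^d are functions nat => int supported on coordinates 0..d-1
  (coordinate i of the paper is index i-1 here).\<close>

definition lattice :: "nat \<Rightarrow> (nat \<Rightarrow> int) set" where
  "lattice d = {x. \<forall>i\<ge>d. x i = 0}"

definition enorm :: "nat \<Rightarrow> (nat \<Rightarrow> int) \<Rightarrow> real" where
  "enorm d x = sqrt (\<Sum>i<d. (real_of_int (x i))^2)"

definition orthantA :: "nat \<Rightarrow> nat \<Rightarrow> (nat \<Rightarrow> int) set" where
  "orthantA d k = {x \<in> lattice d. \<forall>i<k. x i \<ge> 1}"

text \<open>killed_prob d A n x y = P_x(S_n = y, n < tau_{A^c}) for simple random walk on Z^d,
  i.e. the walk stays in A at times 0..n and is at y at time n.\<close>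
fun killed_prob :: "nat \<Rightarrow> (nat \<Rightarrow> int) set \<Rightarrow> nat \<Rightarrow> (nat \<Rightarrow> int) \<Rightarrow> (nat \<Rightarrow> int) \<Rightarrow> real" where
  "killed_prob d A 0 x y = (if x \<in> A \<and> x = y then 1 else 0)"
| "killed_prob d A (Suc n) x y =
     (if x \<in> A then
        (\<Sum>i<d. killed_prob d A n (x(i := x i + 1)) y + killed_prob d A n (x(i := x i - 1)) y)
          / (2 * real d)
      else 0)"

definition greenA :: "nat \<Rightarrow> (nat \<Rightarrow> int) set \<Rightarrow> (nat \<Rightarrow> int) \<Rightarrow> (nat \<Rightarrow> int) \<Rightarrow> real" where
  "greenA d A x y = (1 / (2 * real d)) * (\<Sum>n. killed_prob d A n x y)"

end

theory Submission
  imports Defs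
begin

text \<open>
  The function h(x) = x_1 ... x_k is harmonic in A and vanishes on the boundary. Conjugating the
  lattice Laplacian by h turns it, on functions of |x|^2, into a discrete version of the Laplacian
  in dimension d + 2k = 2b + 2, so powers of |x|^2 + c close to the exponent -b are
  explicit sub- and supersolutions once c or |x| is large. Comparison gives that G_A(o,x) is of
  order h(x) |x|^(-2b).

  If (ii) holds, |y|^(-alpha) G_A(o,y)^q is at most a constant times h(y) |y|^(-2b-2-2 delta) with
  delta > 0, and the supersolution |x|^(-2b) - |x|^(-2b-2 delta) dominates its potential. Conversely, testing
  (i) against h times a cutoff at radius R and letting R tend to infinity shows that
  h(y) |y|^(-alpha) G_A(o,y)^q is summable over A; restricted to dyadic cubes inside the orthant
  this forces (ii).
\<close>

section \<open>Killed random walk\<close>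

text \<open>The obstacle is that at the critical exponent -b the leading term of the conjugated
  Laplacian vanishes, so a pure power is left with a lattice error of unknown sign. That error is
  one order of |x|^2 below the leading term of a general power, uniformly up to the boundary of the
  orthant, which leaves room for a correction by a nearby power. Transience and the upper bound need
  a supersolution at every point of A; the shift c provides it, since it contributes a term of
  definite sign proportional to c while the error constants do not depend on c. The lower bound only
  needs a subsolution off a finite set, because on a finite set a multiple of the Green function
  dominates.

  For (i) implies (ii), heuristically G_A(x,y)/G_A(o,x) tends to h(y)/h(o) as x goes to infinity,
  which would turn (i) directly into summability of h(y) |y|^(-alpha) G_A(o,y)^q. The cutoff
  replaces this limit: (i) is averaged over x against a charge at scale R whose potential is at
  least h/2 on a prescribed finite set.\<close>

definition navg :: "nat \<Rightarrow> ((nat \<Rightarrow> int) \<Rightarrow> real) \<Rightarrow> (nat \<Rightarrow> int) \<Rightarrow> real" where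
  "navg d f x = (\<Sum>i<d. f (x(i := x i + 1)) + f (x(i := x i - 1))) / (2 * real d)"

lemma navg_mono:
  assumes "\<And>i. i < d \<Longrightarrow> f (x(i := x i + 1)) \<le> g (x(i := x i + 1))"
    and "\<And>i. i < d \<Longrightarrow> f (x(i := x i - 1)) \<le> g (x(i := x i - 1))"
  shows "navg d f x \<le> navg d g x"
  unfolding navg_def by (intro divide_right_mono sum_mono add_mono assms) auto

lemma navg_cmult: "navg d (\<lambda>z. c * f z) x = c * navg d f x"
  by (simp add: navg_def sum_distrib_left algebra_simps)

lemma navg_diff: "navg d (\<lambda>z. f z - g z) x = navg d f x - navg d g x"
  by (simp add: navg_def sum_subtractf sum.distrib diff_divide_distrib add_divide_distrib)

lemma navg_sum: "navg d (\<lambda>z. \<Sum>y\<in>F. f y z) x = (\<Sum>y\<in>F. navg d (f y) x)"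
  by (induction F rule: infinite_finite_induct)
     (simp_all add: navg_def sum.distrib add_divide_distrib)

lemma navg_nonneg: "(\<And>z. 0 \<le> f z) \<Longrightarrow> 0 \<le> navg d f x"
  by (simp add: navg_def sum_nonneg)

text \<open>Needed to pass from the first-step recursion of the kernel to a last-step
  recursion.\<close>

lemma navg_swap:
  "navg d (\<lambda>z. navg d (\<lambda>w. f z w) y) x = navg d (\<lambda>w. navg d (\<lambda>z. f z w) x) y"
proof -
  have "(\<Sum>i<d. \<Sum>j<d. f (x(i := x i + 1)) (y(j := y j + 1)) + f (x(i := x i + 1)) (y(j := y j - 1))
      + (f (x(i := x i - 1)) (y(j := y j + 1)) + f (x(i := x i - 1)) (y(j := y j - 1))))
    = (\<Sum>j<d. \<Sum>i<d. f (x(i := x i + 1)) (y(j := y j + 1)) + f (x(i := x i - 1)) (y(j := y j + 1))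
      + (f (x(i := x i + 1)) (y(j := y j - 1)) + f (x(i := x i - 1)) (y(j := y j - 1))))"
    by (subst sum.swap) (intro sum.cong refl, simp)
  thus ?thesis
    unfolding navg_def add_divide_distrib[symmetric] sum.distrib[symmetric] sum_divide_distrib[symmetric]
    by (rule arg_cong[where f="\<lambda>t. t / (2 * real d) / (2 * real d)"])
qed

lemma tendsto_navg:
  assumes "\<And>z. (\<lambda>n. f n z) \<longlonglongrightarrow> g z"
  shows "(\<lambda>n. navg d (f n) x) \<longlonglongrightarrow> navg d g x"
  unfolding navg_def by (cases "d = 0") (auto intro!: tendsto_intros assms)

lemma navg_ge_neighbour:
  assumes "\<And>z. 0 \<le> f z" "i < d" "z = x(i := x i + 1) \<or> z = x(i := x i - 1)"
  shows "f z / (2 * real d) \<le> navg d f x"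
proof -
  have "f z \<le> f (x(i := x i + 1)) + f (x(i := x i - 1))"
    using assms(3) assms(1)[of "x(i := x i + 1)"] assms(1)[of "x(i := x i - 1)"] by auto
  also have "\<dots> \<le> (\<Sum>i<d. f (x(i := x i + 1)) + f (x(i := x i - 1)))"
    by (rule member_le_sum[of i "{..<d}" "\<lambda>i. f (x(i := x i + 1)) + f (x(i := x i - 1))"])
       (use assms in auto)
  finally show ?thesis
    unfolding navg_def by (intro divide_right_mono) auto
qed

lemma navg_less_bound:
  assumes "\<And>z. f z \<le> m" "i < d" "f (x(i := x i + 1)) < m"
  shows "navg d f x < m"
proof -
  have "0 < (m - f (x(i := x i + 1))) / (2 * real d)"
    using assms by simp
  also have "\<dots> \<le> navg d (\<lambda>z. m - f z) x"
    using navg_ge_neighbour[of "\<lambda>z. m - f z" i d] assms by simp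
  also have "\<dots> = m - navg d f x"
    using \<open>i < d\<close> by (simp add: navg_diff) (simp add: navg_def)
  finally show ?thesis by simp
qed

section \<open>Killed kernels, reversibility and comparison principles\<close>

locale killed_walk =
  fixes d :: nat and A :: "(nat \<Rightarrow> int) set"
  assumes d_pos: "0 < d"
begin

abbreviation "K \<equiv> killed_prob d A"
abbreviation "G \<equiv> greenA d A"

lemma K_Suc: "K (Suc n) x y = (if x \<in> A then navg d (\<lambda>z. K n z y) x else 0)"
  by (simp add: navg_def)

lemma K_nonneg: "0 \<le> K n x y"
  by (induction n arbitrary: x) (simp, simp only: K_Suc, simp add: navg_nonneg)

lemma K_outside: "x \<notin> A \<Longrightarrow> K n x y = 0"
  by (cases n) auto

declare killed_prob.simps(2) [simp del]

text \<open>Last-step decomposition. The recursion of \<open>killed_prob\<close> peels off the first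
  step; the averages at the two ends act on different variables and commute, so induction moves the
  step to the other end. Symmetry of the kernel follows.\<close>

lemma K_Suc_right: "K (Suc n) x y = (if y \<in> A then navg d (\<lambda>z. K n x z) y else 0)"
proof (induction n arbitrary: x)
  case 0
  have 1: "x(i := x i + 1) = y \<longleftrightarrow> x = y(i := y i - 1)" for i
    by (auto simp: fun_eq_iff)
  have 2: "x(i := x i - 1) = y \<longleftrightarrow> x = y(i := y i + 1)" for i
    by (auto simp: fun_eq_iff)
  show ?case
  proof (cases "x \<in> A \<and> y \<in> A")
    case True
    have K0: "K 0 z w = of_bool (z = w)" if "z \<in> A \<or> w \<in> A" for z w
      using that by auto
    show ?thesis
      using True by (simp add: K_Suc navg_def K0 1 2 del: killed_prob.simps) (simp add: add.commute)
  next
    case False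
    have "K 0 z w = 0" if "z \<notin> A \<or> w \<notin> A" for z w
      using that by auto
    with False show ?thesis
      by (auto simp: K_Suc navg_def simp del: killed_prob.simps)
  qed
next
  case (Suc n)
  have "K (Suc (Suc n)) x y
      = (if x \<in> A then navg d (\<lambda>z. if y \<in> A then navg d (\<lambda>w. K n z w) y else 0) x else 0)"
    by (subst K_Suc, subst Suc.IH) (rule refl)
  also have "\<dots> = (if y \<in> A then navg d (\<lambda>w. if x \<in> A then navg d (\<lambda>z. K n z w) x else 0) y else 0)"
    by (auto simp: navg_swap[of d "K n"]) (auto simp: navg_def)
  also have "\<dots> = (if y \<in> A then navg d (\<lambda>w. K (Suc n) x w) y else 0)"
    by (simp only: K_Suc)
  finally show ?case .
qed

lemma K_sym: "K n x y = K n y x"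
proof (induction n arbitrary: x y)
  case (Suc n)
  show ?case
    by (subst K_Suc, subst K_Suc_right) (simp add: Suc.IH[of _ y])
qed auto

lemma G_sym: "G x y = G y x"
  by (simp add: greenA_def K_sym[of _ x y])

lemma K_partial_sum:
  "(\<Sum>n<Suc N. K n x y)
    = (if x \<in> A then (if x = y then 1 else 0) + navg d (\<lambda>z. \<Sum>n<N. K n z y) x else 0)"
  by (subst sum.lessThan_Suc_shift) (simp add: K_Suc navg_sum)

text \<open>Induction on the time horizon: by the first-step decomposition, the potential truncated
  at \<open>Suc N\<close> is at most \<open>f x\<close> plus the average of the one truncated at
  \<open>N\<close>. Since only truncated sums occur, this can serve to prove that the Green function
  is finite in the first place.\<close>

lemma partial_comparison:
  assumes "finite F" "\<And>x. 0 \<le> W x" "\<And>x. 0 \<le> f x"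
    and super: "\<And>x. x \<in> A \<Longrightarrow> navg d W x + f x \<le> W x"
  shows "(\<Sum>y\<in>F. (\<Sum>n<N. K n x y) * f y) \<le> W x"
proof (induction N arbitrary: x)
  case (Suc N)
  show ?case
  proof (cases "x \<in> A")
    case True
    have "(\<Sum>y\<in>F. (\<Sum>n<Suc N. K n x y) * f y)
       = (\<Sum>y\<in>F. (if x = y then f x else 0) + f y * navg d (\<lambda>z. \<Sum>n<N. K n z y) x)"
      unfolding K_partial_sum using True by (intro sum.cong) (auto simp: algebra_simps)
    also have "\<dots> = (if x \<in> F then f x else 0) + navg d (\<lambda>z. \<Sum>y\<in>F. (\<Sum>n<N. K n z y) * f y) x"
      using \<open>finite F\<close> by (simp add: sum.distrib navg_sum navg_cmult mult.commute[of _ "f _"])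
    also have "\<dots> \<le> f x + navg d W x"
      using assms(3) by (intro add_mono navg_mono Suc.IH) auto
    finally show ?thesis using super[OF True] by simp
  qed (simp add: K_outside assms(2))
qed (simp add: assms(2))

text \<open>A positive maximum propagates to all neighbours; moving along the first
  coordinate leaves every finite level set.\<close>
lemma maximum_principle:
  assumes out: "\<And>x. x \<notin> A \<Longrightarrow> F x \<le> 0"
    and sub: "\<And>x. x \<in> A \<Longrightarrow> 0 < F x \<Longrightarrow> F x \<le> navg d F x"
    and fin: "\<And>\<epsilon>. 0 < \<epsilon> \<Longrightarrow> finite {x. \<epsilon> \<le> F x}"
  shows "F x \<le> 0"
proof (rule ccontr)
  assume "\<not> F x \<le> 0"
  hence pos: "0 < F x" by simp
  define m where "m = Max (F ` {y. F x \<le> F y})"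
  have m_ge: "F y \<le> m" for y
  proof (cases "F x \<le> F y")
    case True thus ?thesis unfolding m_def by (intro Max_ge) (use fin[OF pos] in auto)
  next
    case False
    have "F x \<le> m" unfolding m_def by (intro Max_ge) (use fin[OF pos] in auto)
    thus ?thesis using False by simp
  qed
  have m_pos: "0 < m" using m_ge[of x] pos by simp
  have "m \<in> F ` {y. F x \<le> F y}"
    unfolding m_def by (intro Max_in) (use fin[OF pos] in auto)
  define E where "E = {y. m \<le> F y}"
  have E: "finite E" "E \<noteq> {}"
    using fin[OF m_pos] \<open>m \<in> _\<close> unfolding E_def by auto
  obtain y where y: "y \<in> E" "\<And>z. z \<in> E \<Longrightarrow> z 0 \<le> y 0"
    using obtains_MAX[OF E, of "\<lambda>y. y 0"] Max_ge E(1)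
    by (metis finite_imageI imageI)
  have Fy: "F y = m" using y m_ge[of y] by (simp add: E_def)
  hence "y \<in> A" using out[of y] m_pos by force
  have "y(0 := y 0 + 1) \<notin> E" using y(2)[of "y(0 := y 0 + 1)"] by auto
  hence "navg d F y < m"
    by (intro navg_less_bound[of F m 0] m_ge d_pos) (simp add: E_def)
  with sub[OF \<open>y \<in> A\<close>] Fy m_pos show False by simp
qed

end

text \<open>Summability is split off into its own locale because for the orthant it is itself
  obtained from the comparison of truncated sums in \<open>killed_walk\<close>.\<close>

locale transient_killed_walk = killed_walk +
  assumes K_summable: "summable (\<lambda>n. K n x y)"
begin

lemma G_nonneg: "0 \<le> G x y"
  by (simp add: greenA_def suminf_nonneg[OF K_summable] K_nonneg)

lemma G_outside: "x \<notin> A \<Longrightarrow> G x y = 0"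
  by (simp add: greenA_def K_outside)

lemma K_partial_sum_tendsto: "(\<lambda>N. \<Sum>n<N. K n x y) \<longlonglongrightarrow> 2 * real d * G x y"
  using summable_LIMSEQ[OF K_summable[of x y]] d_pos by (simp add: greenA_def)

lemma G_equation:
  assumes "x \<in> A"
  shows "G x y = (if x = y then 1 / (2 * real d) else 0) + navg d (\<lambda>z. G z y) x"
proof -
  have "(\<lambda>N. \<Sum>n<Suc N. K n x y) \<longlonglongrightarrow> (if x = y then 1 else 0) + navg d (\<lambda>z. 2 * real d * G z y) x"
    unfolding K_partial_sum using assms
    by (auto intro!: tendsto_intros tendsto_navg K_partial_sum_tendsto)
  with LIMSEQ_Suc[OF K_partial_sum_tendsto[of x y]]
  have "2 * real d * G x y = (if x = y then 1 else 0) + 2 * real d * navg d (\<lambda>z. G z y) x"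
    unfolding navg_cmult by (rule LIMSEQ_unique)
  thus ?thesis using d_pos by (auto simp: field_simps)
qed

lemma G_comparison:
  assumes "finite F" "\<And>x. 0 \<le> W x" "\<And>x. 0 \<le> f x"
    and "\<And>x. x \<in> A \<Longrightarrow> navg d W x + f x \<le> W x"
  shows "2 * real d * (\<Sum>y\<in>F. G x y * f y) \<le> W x"
proof -
  have "(\<lambda>N. \<Sum>y\<in>F. (\<Sum>n<N. K n x y) * f y) \<longlonglongrightarrow> (\<Sum>y\<in>F. 2 * real d * G x y * f y)"
    by (intro tendsto_intros K_partial_sum_tendsto)
  hence "(\<Sum>y\<in>F. 2 * real d * G x y * f y) \<le> W x"
    by (rule LIMSEQ_le_const2) (use partial_comparison[OF assms] in auto)
  thus ?thesis by (simp add: sum_distrib_left algebra_simps)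
qed

end

section \<open>The weighted Laplacian on radial functions\<close>

text \<open>Why order four: a lattice step changes S = |x|^2 by some t of size up to about sqrt S,
  so the remainder S^(p-4) t^4 is of order S^(p-2), one order below the leading S^(p-1). A cubic
  remainder would only give S^(p-3/2).\<close>

lemma powr_taylor4:
  fixes p :: real
  obtains C where "0 \<le> C" "\<And>S t. 0 < S \<Longrightarrow> \<bar>t\<bar> \<le> S / 2 \<Longrightarrow>
    \<bar>(S + t) powr p - (S powr p + p * S powr (p - 1) * t + p * (p - 1) / 2 * S powr (p - 2) * t^2
       + p * (p - 1) * (p - 2) / 6 * S powr (p - 3) * t^3)\<bar> \<le> C * S powr (p - 4) * t^4"
proof
  define C where "C = \<bar>p * (p - 1) * (p - 2) * (p - 3)\<bar> / 24 * 2 powr \<bar>p - 4\<bar>"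
  show "0 \<le> C" by (simp add: C_def)
  fix S t :: real
  assume S: "0 < S" and t: "\<bar>t\<bar> \<le> S / 2"
  define D where "D m z = (\<Prod>j<m. p - real j) * z powr (p - real m)" for m z
  show "\<bar>(S + t) powr p - (S powr p + p * S powr (p - 1) * t + p * (p - 1) / 2 * S powr (p - 2) * t^2
       + p * (p - 1) * (p - 2) / 6 * S powr (p - 3) * t^3)\<bar> \<le> C * S powr (p - 4) * t^4"
  proof (cases "t = 0")
    case False
    have "DERIV (D m) z :> D (Suc m) z" if "S / 2 \<le> z" for m z
    proof -
      have "z > 0" using that S by simp
      have "((\<lambda>z. (\<Prod>j<m. p - real j) * z powr (p - real m)) has_real_derivative
          (\<Prod>j<m. p - real j) * ((p - real m) * z powr (p - real m - 1))) (at z)"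
        by (intro DERIV_cmult has_real_derivative_powr \<open>z > 0\<close>)
      thus ?thesis unfolding D_def by (simp add: diff_diff_eq mult_ac add.commute)
    qed
    hence "\<exists>\<xi>. (if S + t < S then S + t < \<xi> \<and> \<xi> < S else S < \<xi> \<and> \<xi> < S + t) \<and>
      (S + t) powr p = (\<Sum>m<4. D m S / fact m * (S + t - S)^m) + D 4 \<xi> / fact 4 * (S + t - S)^4"
      by (intro Taylor[where a="S/2" and b="2*S" and diff=D])
         (use S t False in \<open>auto simp: D_def abs_le_iff\<close>)
    then obtain \<xi> where \<xi>: "if t < 0 then S + t < \<xi> \<and> \<xi> < S else S < \<xi> \<and> \<xi> < S + t"
      and eq: "(S + t) powr p = (\<Sum>m<4. D m S / fact m * t^m) + D 4 \<xi> / fact 4 * t^4"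
      by auto
    \<comment> \<open>The intermediate point is within a factor 2 of S, which costs at most 2 powr
      |p - 4| whatever the sign of p - 4.\<close>
    have \<xi>': "S / 2 \<le> \<xi>" "\<xi> \<le> 2 * S"
      using \<xi> t S by (auto split: if_splits)
    have "\<xi> powr (p - 4) = S powr (p - 4) * (\<xi> / S) powr (p - 4)"
      using S \<xi>' by (simp add: powr_divide)
    also have "(\<xi> / S) powr (p - 4) \<le> 2 powr \<bar>p - 4\<bar>"
    proof (cases "p \<ge> 4")
      case True
      thus ?thesis using S \<xi>' by (auto intro!: powr_mono2 simp: field_simps)
    next
      case False
      have "(\<xi> / S) powr (p - 4) \<le> (1/2) powr (p - 4)"
        using S \<xi>' False by (intro powr_mono2') (auto simp: field_simps)
      thus ?thesis using False by (simp add: powr_divide powr_minus_divide[symmetric])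
    qed
    finally have \<xi>_le: "\<xi> powr (p - 4) \<le> S powr (p - 4) * 2 powr \<bar>p - 4\<bar>"
      by (simp add: mult_left_mono)
    have "(S + t) powr p - (S powr p + p * S powr (p - 1) * t + p * (p - 1) / 2 * S powr (p - 2) * t^2
       + p * (p - 1) * (p - 2) / 6 * S powr (p - 3) * t^3)
      = p * (p - 1) * (p - 2) * (p - 3) / 24 * \<xi> powr (p - 4) * t^4"
      unfolding eq D_def by (simp add: eval_nat_numeral fact_numeral)
    hence "\<bar>(S + t) powr p - (S powr p + p * S powr (p - 1) * t + p * (p - 1) / 2 * S powr (p - 2) * t^2
       + p * (p - 1) * (p - 2) / 6 * S powr (p - 3) * t^3)\<bar>
      = \<bar>p * (p - 1) * (p - 2) * (p - 3)\<bar> / 24 * \<xi> powr (p - 4) * t^4"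
      by (simp only: abs_mult abs_divide power_even_abs_numeral) (simp add: abs_mult)
    also have "\<dots> \<le> \<bar>p * (p - 1) * (p - 2) * (p - 3)\<bar> / 24 * (S powr (p - 4) * 2 powr \<bar>p - 4\<bar>) * t^4"
      using \<xi>_le by (intro mult_mono) auto
    finally show ?thesis by (simp add: C_def mult_ac)
  qed (use S in simp)
qed

text \<open>Here S stands for |x|^2, possibly shifted, and X for a coordinate, so S + 1 + 2 X is the
  value after a unit step. The cubic coefficient is kept as \<open>S powr (p - 2) / S\<close> so
  that it shares a factor with the error term.\<close>

lemma powr_step_expansion:
  fixes p :: real
  obtains C where "0 \<le> C" "\<And>S X. 25 \<le> S \<Longrightarrow> X^2 \<le> S \<Longrightarrow>
    \<bar>(S + 1 + 2 * X) powr p - (S powr p + p * S powr (p - 1) * (1 + 2 * X)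
       + p * (p - 1) / 2 * S powr (p - 2) * (1 + 2 * X)^2
       + p * (p - 1) * (p - 2) / 6 * (S powr (p - 2) / S) * (1 + 2 * X)^3)\<bar> \<le> C * S powr (p - 2)"
proof -
  obtain C where C: "0 \<le> C" "\<And>S t. 0 < S \<Longrightarrow> \<bar>t\<bar> \<le> S / 2 \<Longrightarrow>
    \<bar>(S + t) powr p - (S powr p + p * S powr (p - 1) * t + p * (p - 1) / 2 * S powr (p - 2) * t^2
       + p * (p - 1) * (p - 2) / 6 * S powr (p - 3) * t^3)\<bar> \<le> C * S powr (p - 4) * t^4"
    using powr_taylor4[of p] by blast
  show ?thesis
  proof
    show "0 \<le> 81 * C" using C(1) by simp
    fix S X :: real
    assume S: "25 \<le> S" and X: "X^2 \<le> S"
    define \<sigma> where "\<sigma> = sqrt S"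
    have \<sigma>: "5 \<le> \<sigma>" "S = \<sigma>^2"
      using S by (auto simp: \<sigma>_def intro!: real_le_rsqrt)
    have "\<bar>X\<bar> \<le> \<sigma>" unfolding \<sigma>_def by (rule real_le_rsqrt) (use X in simp)
    \<comment> \<open>Origin of the threshold 25: for \<sigma> >= 5 one has 2 |1 + 2 X| <= 2 + 4
      \<sigma> <= 5 \<sigma> <= \<sigma>^2 = S.\<close>
    have "5 * \<sigma> \<le> \<sigma>^2" using \<sigma>(1) by (simp add: power2_eq_square)
    hence t: "\<bar>1 + 2 * X\<bar> \<le> S / 2" using \<open>\<bar>X\<bar> \<le> \<sigma>\<close> \<sigma> by linarith
    have "\<bar>1 + 2 * X\<bar>^4 \<le> (3 * \<sigma>)^4"
      using \<open>\<bar>X\<bar> \<le> \<sigma>\<close> \<sigma> by (intro power_mono) auto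
    hence t4: "(1 + 2 * X)^4 \<le> 81 * S^2" by (simp add: \<sigma>(2) power_mult_distrib)
    have "C * S powr (p - 4) * (1 + 2 * X)^4 \<le> C * S powr (p - 4) * (81 * S^2)"
      using C(1) t4 by (intro mult_left_mono) auto
    also have "S powr (p - 4) * S^2 = S powr (p - 2)"
      using S powr_add[of S "p - 4" 2] by simp
    hence "C * S powr (p - 4) * (81 * S^2) = 81 * C * S powr (p - 2)"
      by (simp add: mult_ac)
    finally have "C * S powr (p - 4) * (1 + 2 * X)^4 \<le> 81 * C * S powr (p - 2)" .
    moreover have "S powr (p - 3) = S powr (p - 2) / S"
      using S by (simp add: powr_diff power3_eq_cube power2_eq_square)
    ultimately show "\<bar>(S + 1 + 2 * X) powr p - (S powr p + p * S powr (p - 1) * (1 + 2 * X)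
       + p * (p - 1) / 2 * S powr (p - 2) * (1 + 2 * X)^2
       + p * (p - 1) * (p - 2) / 6 * (S powr (p - 2) / S) * (1 + 2 * X)^3)\<bar> \<le> 81 * C * S powr (p - 2)"
      using C(2)[OF _ t] S by (simp add: add.assoc)
  qed
qed

text \<open>Parity does the work. Up to the remainder, the sum keeps only even powers of X, and the
  difference is odd in X, so that after division by X its cubic part is still of order S^(p-2).
  Dividing the remainder by X >= 1 does no harm.\<close>

lemma powr_differences:
  fixes p :: real
  obtains C where "0 \<le> C"
    "\<And>S X. 25 \<le> S \<Longrightarrow> X^2 \<le> S \<Longrightarrow>
      \<bar>(S + 1 + 2 * X) powr p + (S + 1 - 2 * X) powr p - 2 * S powr p
        - (2 * p * S powr (p - 1) + 4 * p * (p - 1) * S powr (p - 2) * X^2)\<bar> \<le> C * S powr (p - 2)"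
    "\<And>S X. 25 \<le> S \<Longrightarrow> X^2 \<le> S \<Longrightarrow> 1 \<le> X \<Longrightarrow>
      \<bar>((S + 1 + 2 * X) powr p - (S + 1 - 2 * X) powr p) / X - 4 * p * S powr (p - 1)\<bar>
        \<le> C * S powr (p - 2)"
proof -
  define f where "f S X = S powr p + p * S powr (p - 1) * (1 + 2 * X)
       + p * (p - 1) / 2 * S powr (p - 2) * (1 + 2 * X)^2
       + p * (p - 1) * (p - 2) / 6 * (S powr (p - 2) / S) * (1 + 2 * X)^3" for S X :: real
  obtain C where C: "0 \<le> C" and C': "\<And>S X. 25 \<le> S \<Longrightarrow> X^2 \<le> S \<Longrightarrow>
    \<bar>(S + 1 + 2 * X) powr p - f S X\<bar> \<le> C * S powr (p - 2)"
    unfolding f_def using powr_step_expansion[of p] by blast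
  define a b where "a = \<bar>p * (p - 1)\<bar>" and "b = \<bar>p * (p - 1) * (p - 2) / 6\<bar>"
  have ab: "0 \<le> a" "0 \<le> b" by (auto simp: a_def b_def)
  show ?thesis
  proof
    show "0 \<le> 2 * C + 4 * a + 28 * b" using C ab by simp
    fix S X :: real
    assume S: "25 \<le> S" and X: "X^2 \<le> S"
    define V where "V = S powr (p - 2)"
    have V: "0 \<le> V" by (simp add: V_def)
    define e where "e X = (S + 1 + 2 * X) powr p - f S X" for X
    have e: "\<bar>e X\<bar> \<le> C * V" "\<bar>e (-X)\<bar> \<le> C * V"
      using C'[OF S X] C'[OF S, of "-X"] X by (auto simp: e_def V_def)
    define y where "y = 1 / S"
    define r where "r = X^2 * y"
    have r: "0 \<le> r" "r \<le> 1" "0 \<le> y" "y \<le> 1" using S X by (auto simp: r_def y_def)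
    have Vy: "V / S = V * y" by (simp add: y_def)
    \<comment> \<open>The number 28 covers both cubic contributions, 2 y + 24 r for the sum and 12 y
      + 16 r for the difference, with y and r at most 1.\<close>
    have cube: "\<bar>p * (p - 1) * (p - 2) / 6 * V * y\<bar> \<le> 28 * b * V" if "0 \<le> y" "y \<le> 28" for y
    proof -
      have "\<bar>p * (p - 1) * (p - 2) / 6 * V * y\<bar> = b * V * y"
        using V that by (simp add: b_def abs_mult)
      also have "\<dots> \<le> b * V * 28" using V ab that by (intro mult_left_mono) auto
      finally show ?thesis by simp
    qed
    have "(S + 1 + 2 * X) powr p + (S + 1 - 2 * X) powr p - 2 * S powr p
        - (2 * p * S powr (p - 1) + 4 * p * (p - 1) * V * X^2)
      = e X + e (-X) + p * (p - 1) * V + p * (p - 1) * (p - 2) / 6 * V * (2 * y + 24 * r)"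
      unfolding e_def f_def V_def[symmetric] Vy r_def
      by (simp add: field_simps power2_eq_square power3_eq_cube)
    moreover have "\<bar>p * (p - 1) * V\<bar> = a * V" using V by (simp add: a_def abs_mult)
    moreover have "0 \<le> a * V" using ab V by simp
    ultimately show "\<bar>(S + 1 + 2 * X) powr p + (S + 1 - 2 * X) powr p - 2 * S powr p
        - (2 * p * S powr (p - 1) + 4 * p * (p - 1) * S powr (p - 2) * X^2)\<bar>
      \<le> (2 * C + 4 * a + 28 * b) * S powr (p - 2)"
      unfolding V_def[symmetric] using e cube[of "2 * y + 24 * r"] r
      by (simp add: distrib_right)
    assume X1: "1 \<le> X"
    have eX: "\<bar>(e X - e (-X)) / X\<bar> \<le> 2 * C * V"
    proof -
      have "\<bar>(e X - e (-X)) / X\<bar> \<le> \<bar>e X - e (-X)\<bar>"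
        using X1 mult_right_mono[OF X1, of "\<bar>e X - e (-X)\<bar>"] by (simp add: field_simps)
      thus ?thesis using e by simp
    qed
    have "(S + 1 + 2 * X) powr p - (S + 1 - 2 * X) powr p
      = (e X - e (-X)) + X * (4 * p * S powr (p - 1) + 4 * (p * (p - 1) * V)
        + p * (p - 1) * (p - 2) / 6 * V * (12 * y + 16 * r))"
      unfolding e_def f_def V_def[symmetric] Vy r_def
      by (simp add: field_simps power2_eq_square power3_eq_cube)
    hence "((S + 1 + 2 * X) powr p - (S + 1 - 2 * X) powr p) / X - 4 * p * S powr (p - 1)
      = (e X - e (-X)) / X + 4 * (p * (p - 1) * V)
        + p * (p - 1) * (p - 2) / 6 * V * (12 * y + 16 * r)"
      using X1 by (simp add: add_divide_distrib)
    moreover have "\<bar>p * (p - 1) * V\<bar> = a * V" using V by (simp add: a_def abs_mult)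
    ultimately show "\<bar>((S + 1 + 2 * X) powr p - (S + 1 - 2 * X) powr p) / X - 4 * p * S powr (p - 1)\<bar>
        \<le> (2 * C + 4 * a + 28 * b) * S powr (p - 2)"
      unfolding V_def[symmetric] distrib_right using eX cube[of "12 * y + 16 * r"] r by linarith
  qed
qed

section \<open>The harmonic weight and the conjugated Laplacian\<close>

definition sqn :: "nat \<Rightarrow> (nat \<Rightarrow> int) \<Rightarrow> real" where
  "sqn d x = (\<Sum>i<d. (real_of_int (x i))^2)"

definition hprod :: "nat \<Rightarrow> (nat \<Rightarrow> int) \<Rightarrow> real" where
  "hprod k x = (\<Prod>i<k. real_of_int (x i))"

lemma enorm_sqn: "enorm d x = sqrt (sqn d x)"
  by (simp add: enorm_def sqn_def)

lemma sq_le_sqn: "i < d \<Longrightarrow> (real_of_int (x i))^2 \<le> sqn d x"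
  unfolding sqn_def by (rule member_le_sum) auto

lemma sqn_upd: "i < d \<Longrightarrow> sqn d (x(i := a)) = sqn d x - (real_of_int (x i))^2 + (real_of_int a)^2"
  unfolding sqn_def by (simp add: sum.remove[of "{..<d}" i])

lemma hprod_upd_ge: "k \<le> i \<Longrightarrow> hprod k (x(i := a)) = hprod k x"
  unfolding hprod_def by (intro prod.cong) auto

lemma hprod_upd_less:
  assumes "i < k" "x i \<noteq> 0"
  shows "hprod k (x(i := a)) = hprod k x * (real_of_int a / real_of_int (x i))"
  unfolding hprod_def using assms by (simp add: prod.remove[of "{..<k}" i])

text \<open>The lattice Laplacian of x \<mapsto> h(x) \<phi>(|x|^2), divided by h(x).\<close>
definition wlap :: "nat \<Rightarrow> nat \<Rightarrow> (nat \<Rightarrow> int) \<Rightarrow> (real \<Rightarrow> real) \<Rightarrow> real" where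
  "wlap d k x \<phi> = (\<Sum>i<d. \<phi> (sqn d x + 1 + 2 * x i) + \<phi> (sqn d x + 1 - 2 * x i) - 2 * \<phi> (sqn d x)
      + (if i < k then (\<phi> (sqn d x + 1 + 2 * x i) - \<phi> (sqn d x + 1 - 2 * x i)) / x i else 0))"

lemma wlap_add: "wlap d k x (\<lambda>s. \<phi> s + \<psi> s) = wlap d k x \<phi> + wlap d k x \<psi>"
  unfolding wlap_def sum.distrib[symmetric]
  by (intro sum.cong) (auto simp: add_divide_distrib diff_divide_distrib)

lemma wlap_cmult: "wlap d k x (\<lambda>s. c * \<phi> s) = c * wlap d k x \<phi>"
  unfolding wlap_def sum_distrib_left
  by (intro sum.cong) (auto simp: field_simps)

lemma wlap_const: "wlap d k x (\<lambda>s. c) = 0"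
  unfolding wlap_def by (intro sum.neutral) auto

locale orthant =
  fixes d k :: nat
  assumes d3: "3 \<le> d" and k1: "1 \<le> k" and kd: "k \<le> d"
begin

abbreviation "A \<equiv> orthantA d k"
abbreviation "s \<equiv> sqn d"
abbreviation "h \<equiv> hprod k"
abbreviation "L \<equiv> wlap d k"

definition b :: real where "b = (real d + 2 * real k - 2) / 2"

sublocale killed_walk d A
  by unfold_locales (use d3 in simp)

lemma A_coord: "x \<in> A \<Longrightarrow> i < k \<Longrightarrow> 1 \<le> x i"
  by (simp add: orthantA_def)

lemma h_pos: "x \<in> A \<Longrightarrow> 0 < h x"
  unfolding hprod_def by (intro prod_pos) (force dest: A_coord)

lemma s_nonneg: "0 \<le> s x"
  by (simp add: sqn_def sum_nonneg)

lemma s_ge_1: assumes "x \<in> A" shows "1 \<le> s x"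
proof -
  have "1 \<le> x 0" using A_coord[OF assms] k1 by simp
  hence "1 \<le> (real_of_int (x 0))^2" by simp
  also have "\<dots> \<le> s x" using d3 by (intro sq_le_sqn) auto
  finally show ?thesis .
qed

lemma b_pos: "0 < b" using d3 k1 by (simp add: b_def)

lemma h_sq_le: "x \<in> A \<Longrightarrow> (h x)^2 \<le> s x ^ k"
proof -
  assume "x \<in> A"
  have "(h x)^2 = (\<Prod>i<k. (real_of_int (x i))^2)" by (simp add: hprod_def prod_power_distrib)
  also have "\<dots> \<le> (\<Prod>i<k. s x)" using kd by (intro prod_mono) (auto intro: sq_le_sqn)
  finally show ?thesis by simp
qed

text \<open>A step out of the orthant can only turn one of the first k coordinates from 1 into 0,
  and then the product \<open>h\<close> vanishes. Hence h times a radial function meets the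
  Dirichlet condition without boundary corrections.\<close>

lemma neighbour_cases:
  assumes "x \<in> A" "i < d" "a = 1 \<or> a = -1"
  shows "x(i := x i + a) \<in> A \<or> h (x(i := x i + a)) = 0"
proof (cases "i < k \<and> x i + a = 0")
  case True
  thus ?thesis by (auto simp: hprod_def intro!: prod_zero)
next
  case False
  have "x(i := x i + a) \<in> A"
    using assms False A_coord[of x i] by (auto simp: orthantA_def lattice_def)
  thus ?thesis ..
qed

text \<open>The explicit cut is essential: off A, \<open>h\<close> need not vanish, for instance
  when some of the first k coordinates are negative and none is 0.\<close>

definition radial :: "(real \<Rightarrow> real) \<Rightarrow> (nat \<Rightarrow> int) \<Rightarrow> real" where
  "radial \<phi> x = (if x \<in> A then h x * \<phi> (s x) else 0)"

text \<open>For i < k a step in direction i multiplies h by 1 + 1/x_i or 1 - 1/x_i; for i >= k it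
  leaves h alone. Pulling out h(x) leaves exactly the summands of \<open>wlap\<close>, and
  \<open>neighbour_cases\<close> makes this valid for neighbours off A as well.\<close>

lemma radial_navg:
  assumes "x \<in> A"
  shows "navg d (radial \<phi>) x = radial \<phi> x + h x * L x \<phi> / (2 * real d)"
proof -
  have up: "radial \<phi> (x(i := x i + 1)) = h x * (1 + (if i < k then 1 / x i else 0)) * \<phi> (s x + 1 + 2 * x i)"
    and dn: "radial \<phi> (x(i := x i - 1)) = h x * (1 - (if i < k then 1 / x i else 0)) * \<phi> (s x + 1 - 2 * x i)"
    if i: "i < d" for i
  proof -
    have hh: "h (x(i := x i + a)) = h x * (1 + (if i < k then a / x i else 0))" for a
      using A_coord[OF assms, of i]
      by (cases "i < k") (auto simp: hprod_upd_less hprod_upd_ge add_divide_distrib)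
    have ss: "s (x(i := x i + a)) = s x + 2 * a * x i + a^2" for a
      using i by (simp add: sqn_upd power2_eq_square algebra_simps)
    have rr: "radial \<phi> (x(i := x i + a)) = h (x(i := x i + a)) * \<phi> (s (x(i := x i + a)))"
      if "a = 1 \<or> a = -1" for a
      using neighbour_cases[OF assms i that] by (auto simp: radial_def)
    show "radial \<phi> (x(i := x i + 1)) = h x * (1 + (if i < k then 1 / x i else 0)) * \<phi> (s x + 1 + 2 * x i)"
      using rr[of 1] hh[of 1] ss[of 1] by (simp add: add_ac)
    show "radial \<phi> (x(i := x i - 1)) = h x * (1 - (if i < k then 1 / x i else 0)) * \<phi> (s x + 1 - 2 * x i)"
    proof -
      have "s (x(i := x i - 1)) = s x + 1 - 2 * x i" using ss[of "-1"] by simp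
      thus ?thesis using rr[of "-1"] hh[of "-1"] by auto
    qed
  qed
  have "(\<Sum>i<d. radial \<phi> (x(i := x i + 1)) + radial \<phi> (x(i := x i - 1)))
     = (\<Sum>i<d. 2 * radial \<phi> x + h x * (\<phi> (s x + 1 + 2 * x i) + \<phi> (s x + 1 - 2 * x i) - 2 * \<phi> (s x)
      + (if i < k then (\<phi> (s x + 1 + 2 * x i) - \<phi> (s x + 1 - 2 * x i)) / x i else 0)))"
  proof (intro sum.cong refl)
    fix i assume "i \<in> {..<d}"
    hence i: "i < d" by simp
    show "radial \<phi> (x(i := x i + 1)) + radial \<phi> (x(i := x i - 1))
      = 2 * radial \<phi> x + h x * (\<phi> (s x + 1 + 2 * x i) + \<phi> (s x + 1 - 2 * x i) - 2 * \<phi> (s x)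
        + (if i < k then (\<phi> (s x + 1 + 2 * x i) - \<phi> (s x + 1 - 2 * x i)) / x i else 0))"
      unfolding up[OF i] dn[OF i] radial_def[of \<phi> x] using assms
      by (simp add: algebra_simps diff_divide_distrib)
  qed
  also have "\<dots> = 2 * real d * radial \<phi> x + h x * L x \<phi>"
    by (simp add: sum.distrib sum_distrib_left[symmetric] wlap_def)
  finally show ?thesis
    using d_pos by (simp add: navg_def add_divide_distrib)
qed

text \<open>The weighted Laplacian acts on radial functions like the Laplacian in dimension
  d + 2k, so the exponent p = -b is the one of its fundamental solution.  The
  error constant does not depend on c.\<close>
lemma L_powr:
  fixes p :: real
  obtains C where "0 \<le> C" "\<And>c x. x \<in> A \<Longrightarrow> 0 \<le> c \<Longrightarrow> 25 \<le> s x + c \<Longrightarrow>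
    \<bar>L x (\<lambda>r. (r + c) powr p)
      - (4 * p * (p + b) * (s x + c) powr (p - 1) - 4 * p * (p - 1) * c * (s x + c) powr (p - 2))\<bar>
      \<le> C * (s x + c) powr (p - 2)"
proof -
  obtain C where C: "0 \<le> C"
    and C1: "\<And>S X. 25 \<le> S \<Longrightarrow> X^2 \<le> S \<Longrightarrow>
      \<bar>(S + 1 + 2 * X) powr p + (S + 1 - 2 * X) powr p - 2 * S powr p
        - (2 * p * S powr (p - 1) + 4 * p * (p - 1) * S powr (p - 2) * X^2)\<bar> \<le> C * S powr (p - 2)"
    and C2: "\<And>S X. 25 \<le> S \<Longrightarrow> X^2 \<le> S \<Longrightarrow> 1 \<le> X \<Longrightarrow>
      \<bar>((S + 1 + 2 * X) powr p - (S + 1 - 2 * X) powr p) / X - 4 * p * S powr (p - 1)\<bar>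
        \<le> C * S powr (p - 2)"
    using powr_differences[of p] by blast
  show ?thesis
  proof
    show "0 \<le> real d * (2 * C)" using C by simp
    fix c x assume x: "x \<in> A" and c: "0 \<le> c" and S: "25 \<le> s x + c"
    define S where "S = s x + c"
    define T where "T i = (S + 1 + 2 * x i) powr p + (S + 1 - 2 * x i) powr p - 2 * S powr p
      + (if i < k then ((S + 1 + 2 * x i) powr p - (S + 1 - 2 * x i) powr p) / x i else 0)" for i
    define M where "M i = 2 * p * S powr (p - 1) + 4 * p * (p - 1) * S powr (p - 2) * (x i)^2
      + (if i < k then 4 * p * S powr (p - 1) else 0)" for i
    have S25: "25 \<le> S" using S by (simp add: S_def)
    have "\<bar>T i - M i\<bar> \<le> 2 * C * S powr (p - 2)" if "i < d" for i
    proof -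
      have xi: "(real_of_int (x i))^2 \<le> S"
        using sq_le_sqn[OF that, of x] c by (simp add: S_def)
      have "0 \<le> C * S powr (p - 2)" using C by simp
      thus ?thesis
        using C1[OF S25 xi] C2[OF S25 xi] A_coord[OF x, of i] by (auto simp: T_def M_def)
    qed
    hence "\<bar>(\<Sum>i<d. T i - M i)\<bar> \<le> (\<Sum>i<d. 2 * C * S powr (p - 2))"
      by (intro order_trans[OF sum_abs] sum_mono) auto
    moreover have "(\<Sum>i<d. T i) = L x (\<lambda>r. (r + c) powr p)"
      unfolding wlap_def T_def S_def by (intro sum.cong) (auto simp: algebra_simps)
    \<comment> \<open>The coefficients of S^(p-1) add up to 2 p d + 4 p (p - 1) + 4 p k = 4 p (p +
      b); writing s x as S - c produces the additional term with c.\<close>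
    moreover have "(\<Sum>i<d. M i) = 4 * p * (p + b) * S powr (p - 1) - 4 * p * (p - 1) * c * S powr (p - 2)"
    proof -
      have "(\<Sum>i<d. if i < k then 4 * p * S powr (p - 1) else 0) = real k * (4 * p * S powr (p - 1))"
      proof -
        have "{..<d} \<inter> {i. i < k} = {..<k}" using kd by auto
        thus ?thesis by (simp add: sum.If_cases)
      qed
      hence "(\<Sum>i<d. M i) = real d * (2 * p * S powr (p - 1)) + 4 * p * (p - 1) * S powr (p - 2) * s x
          + real k * (4 * p * S powr (p - 1))"
        unfolding M_def sum.distrib sqn_def by (simp add: sum_distrib_left)
      moreover have "S powr (p - 1) = S powr (p - 2) * S"
        using S25 powr_add[of S "p - 2" 1] by simp
      moreover have "s x = S - c" by (simp add: S_def)
      ultimately show ?thesis by (simp add: b_def field_simps)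
    qed
    ultimately show "\<bar>L x (\<lambda>r. (r + c) powr p)
      - (4 * p * (p + b) * (s x + c) powr (p - 1) - 4 * p * (p - 1) * c * (s x + c) powr (p - 2))\<bar>
      \<le> real d * (2 * C) * (s x + c) powr (p - 2)"
      by (simp add: sum_subtractf S_def mult_ac)
  qed
qed

end

section \<open>Two-sided bounds for the Green function\<close>

definition box :: "nat \<Rightarrow> int \<Rightarrow> int \<Rightarrow> (nat \<Rightarrow> int) set" where
  "box d l u = {x \<in> lattice d. \<forall>i<d. l \<le> x i \<and> x i < u}"

lemma box_bij: "bij_betw (\<lambda>x. restrict x {..<d}) (box d l u) ({..<d} \<rightarrow>\<^sub>E {l..<u})"
proof (rule bij_betw_byWitness[where f' = "\<lambda>f i. if i < d then f i else 0"])
  show "\<forall>x\<in>box d l u. (\<lambda>i. if i < d then restrict x {..<d} i else 0) = x"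
    by (auto simp: box_def lattice_def fun_eq_iff)
  show "\<forall>f\<in>{..<d} \<rightarrow>\<^sub>E {l..<u}. restrict (\<lambda>i. if i < d then f i else 0) {..<d} = f"
  proof
    fix f assume "f \<in> {..<d} \<rightarrow>\<^sub>E {l..<u}"
    hence "f i = undefined" if "\<not> i < d" for i using that by (auto simp: PiE_iff extensional_def)
    thus "restrict (\<lambda>i. if i < d then f i else 0) {..<d} = f" by (intro ext) simp
  qed
  show "(\<lambda>x. restrict x {..<d}) ` box d l u \<subseteq> {..<d} \<rightarrow>\<^sub>E {l..<u}"
    unfolding box_def by (intro image_subsetI PiE_I) auto
  show "(\<lambda>f i. if i < d then f i else 0) ` ({..<d} \<rightarrow>\<^sub>E {l..<u}) \<subseteq> box d l u"
  proof (rule image_subsetI)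
    fix f assume f: "f \<in> {..<d} \<rightarrow>\<^sub>E {l..<u}"
    have "l \<le> f i \<and> f i < u" if "i < d" for i
      using PiE_mem[OF f, of i] that by simp
    thus "(\<lambda>i. if i < d then f i else 0) \<in> box d l u" by (simp add: box_def lattice_def)
  qed
qed

lemma finite_box: "finite (box d l u)"
  unfolding bij_betw_finite[OF box_bij] by (intro finite_PiE) auto

lemma card_box: "card (box d l u) = nat (u - l) ^ d"
proof -
  have "card (box d l u) = card ({..<d} \<rightarrow>\<^sub>E {l..<u})" by (rule bij_betw_same_card[OF box_bij])
  also have "\<dots> = (\<Prod>i<d. card {l..<u})" by (rule card_PiE) simp
  finally show ?thesis by simp
qed

lemma sublevel_subset_box:
  assumes "\<rho> \<le> (real m)^2"
  shows "{x \<in> lattice d. sqn d x \<le> \<rho>} \<subseteq> box d (- int m) (int m + 1)"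
proof
  fix x assume x: "x \<in> {x \<in> lattice d. sqn d x \<le> \<rho>}"
  have "- int m \<le> x i \<and> x i < int m + 1" if "i < d" for i
  proof -
    have "(real_of_int (x i))^2 \<le> (real m)^2"
      using sq_le_sqn[OF that, of x] x assms by simp
    hence "\<bar>real_of_int (x i)\<bar> \<le> real m" by (simp add: abs_le_square_iff[symmetric])
    thus ?thesis by linarith
  qed
  thus "x \<in> box d (- int m) (int m + 1)" using x by (simp add: box_def)
qed

lemma finite_sublevel: "finite {x \<in> lattice d. sqn d x \<le> \<rho>}"
proof -
  obtain m :: nat where m: "max 1 \<rho> \<le> real m" using real_arch_simple by blast
  hence "\<rho> \<le> real m * 1" by simp
  also have "\<dots> \<le> (real m)^2" unfolding power2_eq_square using m by (intro mult_left_mono) auto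
  finally show ?thesis using sublevel_subset_box finite_box finite_subset by metis
qed

context orthant
begin

section \<open>Explicit barriers and transience\<close>

text \<open>Through its shift the leading power contributes - a1 c T^(-b-2), with error C1 T^(-b-2).
  The subtracted power contributes - \<kappa> T^(-b-1-\<delta>), where \<kappa> > 0 because p and p
  + b are both negative, and further terms carrying a factor T^(-\<delta>) <= c^(-\<delta>). For
  large c the first term absorbs all but the \<kappa> term. This allows every \<delta> > 0, even
  \<delta> > 1, where the \<kappa> term decays faster than the lattice error.\<close>

lemma supersolution:
  assumes "0 < \<delta>"
  obtains c \<kappa> where "25 \<le> c" "0 < \<kappa>"
    "\<And>x. x \<in> A \<Longrightarrow> L x (\<lambda>r. (r + c) powr (-b) - (r + c) powr (-b - \<delta>)) \<le> - \<kappa> * (s x + c) powr (-b - 1 - \<delta>)"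
    "\<And>r. 0 \<le> r \<Longrightarrow> 0 \<le> (r + c) powr (-b) - (r + c) powr (-b - \<delta>)"
proof -
  obtain C1 where C1: "0 \<le> C1" "\<And>c x. x \<in> A \<Longrightarrow> 0 \<le> c \<Longrightarrow> 25 \<le> s x + c \<Longrightarrow>
    \<bar>L x (\<lambda>r. (r + c) powr (-b))
      - (4 * (-b) * (-b + b) * (s x + c) powr (-b - 1) - 4 * (-b) * (-b - 1) * c * (s x + c) powr (-b - 2))\<bar>
      \<le> C1 * (s x + c) powr (-b - 2)"
    using L_powr[of "-b"] by blast
  define p where "p = -b - \<delta>"
  obtain C2 where C2: "0 \<le> C2" "\<And>c x. x \<in> A \<Longrightarrow> 0 \<le> c \<Longrightarrow> 25 \<le> s x + c \<Longrightarrow>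
    \<bar>L x (\<lambda>r. (r + c) powr p)
      - (4 * p * (p + b) * (s x + c) powr (p - 1) - 4 * p * (p - 1) * c * (s x + c) powr (p - 2))\<bar>
      \<le> C2 * (s x + c) powr (p - 2)"
    using L_powr[of p] by blast
  define a1 a2 \<kappa> where "a1 = 4 * b * (b + 1)" and "a2 = 4 * p * (p - 1)" and "\<kappa> = 4 * p * (p + b)"
  have a1: "0 < a1" using b_pos by (simp add: a1_def)
  have p: "p < 0" "p - 1 < 0" "p + b < 0" using b_pos assms by (auto simp: p_def)
  have a2: "0 < a2" unfolding a2_def using mult_neg_neg[OF p(1,2)] by simp
  have \<kappa>: "0 < \<kappa>" unfolding \<kappa>_def using mult_neg_neg[OF p(1,3)] by simp
  \<comment> \<open>The shift c is taken so large that a2 c^(-\<delta>) <= a1 / 2 and C1 + C2 <= a1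
    c / 2: each half of a1 c pays for one group of terms. The bound c^(-\<delta>) <= 1 removes the
    factor next to C2.\<close>
  have lim: "((\<lambda>c. c powr (-\<delta>)) \<longlongrightarrow> 0) at_top"
    using assms by (intro tendsto_neg_powr filterlim_ident) auto
  have "\<forall>\<^sub>F c in at_top. c powr (-\<delta>) < min 1 (a1 / (2 * a2))"
    using a1 a2 by (intro order_tendstoD(2)[OF lim]) auto
  moreover have "\<forall>\<^sub>F c in at_top. max 25 (2 * (C1 + C2) / a1) \<le> c"
    by (rule eventually_ge_at_top)
  ultimately have "\<exists>c. c powr (-\<delta>) < min 1 (a1 / (2 * a2)) \<and> max 25 (2 * (C1 + C2) / a1) \<le> c"
    by (metis (mono_tags, lifting) eventually_conj eventually_happens' trivial_limit_at_top_linorder)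
  then obtain c where c0: "c powr (-\<delta>) < min 1 (a1 / (2 * a2))" "max 25 (2 * (C1 + C2) / a1) \<le> c"
    by blast
  hence c: "c powr (-\<delta>) \<le> 1" "c powr (-\<delta>) * a2 * 2 \<le> a1" "25 \<le> c" "2 * (C1 + C2) \<le> a1 * c"
    using a1 a2 by (auto simp: field_simps)
  have pd: "T powr (-\<delta>) \<le> c powr (-\<delta>)" if "c \<le> T" for T
    using that c(3) assms by (intro powr_mono2') auto
  show ?thesis
  proof
    show "25 \<le> c" "0 < \<kappa>" by fact+
    show "0 \<le> (r + c) powr (-b) - (r + c) powr (-b - \<delta>)" if "0 \<le> r" for r
      using that c(3) assms by (simp add: powr_mono)
    fix x assume x: "x \<in> A"
    define T where "T = s x + c"
    have T: "c \<le> T" "25 \<le> T" "0 < T" using s_nonneg[of x] c(3) by (auto simp: T_def)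
    define V where "V = T powr (-b - 2)"
    define z where "z = T powr (-\<delta>)"
    have V: "0 \<le> V" by (simp add: V_def)
    have z: "0 \<le> z" "z \<le> 1" "z * a2 * 2 \<le> a1"
    proof -
      show "0 \<le> z" by (simp add: z_def)
      show "z \<le> 1" using pd[OF T(1)] c(1) by (simp add: z_def)
      have "z * a2 * 2 \<le> c powr (-\<delta>) * a2 * 2"
        using pd[OF T(1)] a2 by (simp add: z_def)
      thus "z * a2 * 2 \<le> a1" using c(2) by simp
    qed
    have Vz: "T powr (p - 2) = V * z"
      unfolding V_def z_def powr_add[symmetric] by (rule arg_cong) (simp add: p_def)
    have "L x (\<lambda>r. (r + c) powr (-b)) \<le> - a1 * c * V + C1 * V"
      using C1(2)[OF x, of c] c(3) T(2) by (simp add: T_def V_def a1_def algebra_simps abs_le_iff)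
    moreover have "L x (\<lambda>r. (r + c) powr p) \<ge> \<kappa> * T powr (p - 1) - a2 * c * (V * z) - C2 * (V * z)"
      using C2(2)[OF x, of c] c(3) T(2)
      unfolding T_def[symmetric] Vz \<kappa>_def[symmetric] a2_def[symmetric] by (simp add: abs_le_iff)
    moreover have "L x (\<lambda>r. (r + c) powr (-b) - (r + c) powr p)
        = L x (\<lambda>r. (r + c) powr (-b)) - L x (\<lambda>r. (r + c) powr p)"
      using wlap_add[of d k x "\<lambda>r. (r + c) powr (-b)" "\<lambda>r. (-1) * (r + c) powr p"]
      unfolding wlap_cmult by simp
    moreover have "(a2 * c + C2) * (V * z) \<le> (a1 * c - C1) * V"
    proof -
      have "z * a2 * 2 * c \<le> a1 * c" using z(3) c(3) by (intro mult_right_mono) auto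
      moreover have "C2 * z \<le> C2" using C2(1) z by (simp add: mult_left_le)
      ultimately have "(a2 * c + C2) * z \<le> a1 * c - C1" using c(4) by (simp add: algebra_simps)
      hence "(a2 * c + C2) * z * V \<le> (a1 * c - C1) * V" using V by (rule mult_right_mono)
      thus ?thesis by (simp add: mult_ac)
    qed
    moreover have "p - 1 = -b - 1 - \<delta>" by (simp add: p_def)
    ultimately show "L x (\<lambda>r. (r + c) powr (-b) - (r + c) powr (-b - \<delta>)) \<le> - \<kappa> * (s x + c) powr (-b - 1 - \<delta>)"
      unfolding T_def[symmetric] p_def[symmetric] by (simp add: algebra_simps)
  qed
qed

text \<open>Now the correction is added and the shift is 0. At exponent -b - 1/2 its main term
  \<kappa> S^(-b-3/2) exceeds the errors of order S^(-b-2) by a factor sqrt S, whence the threshold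
  ((C1 + C2) / \<kappa>)^2.\<close>

lemma subsolution:
  obtains R where "\<And>x. x \<in> A \<Longrightarrow> R \<le> s x \<Longrightarrow> 0 \<le> L x (\<lambda>r. r powr (-b) + r powr (-b - 1/2))"
proof -
  obtain C1 where C1: "0 \<le> C1" "\<And>c x. x \<in> A \<Longrightarrow> 0 \<le> c \<Longrightarrow> 25 \<le> s x + c \<Longrightarrow>
    \<bar>L x (\<lambda>r. (r + c) powr (-b))
      - (4 * (-b) * (-b + b) * (s x + c) powr (-b - 1) - 4 * (-b) * (-b - 1) * c * (s x + c) powr (-b - 2))\<bar>
      \<le> C1 * (s x + c) powr (-b - 2)"
    using L_powr[of "-b"] by blast
  define p where "p = -b - 1/2"
  obtain C2 where C2: "0 \<le> C2" "\<And>c x. x \<in> A \<Longrightarrow> 0 \<le> c \<Longrightarrow> 25 \<le> s x + c \<Longrightarrow>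
    \<bar>L x (\<lambda>r. (r + c) powr p)
      - (4 * p * (p + b) * (s x + c) powr (p - 1) - 4 * p * (p - 1) * c * (s x + c) powr (p - 2))\<bar>
      \<le> C2 * (s x + c) powr (p - 2)"
    using L_powr[of p] by blast
  define \<kappa> where "\<kappa> = 4 * p * (p + b)"
  have p: "p < 0" "p + b < 0" using b_pos by (auto simp: p_def)
  have \<kappa>: "0 < \<kappa>" unfolding \<kappa>_def using mult_neg_neg[OF p] by simp
  show ?thesis
  proof
    fix x assume x: "x \<in> A" and R: "max 25 (((C1 + C2) / \<kappa>)^2) \<le> s x"
    define S where "S = s x"
    define V where "V = S powr (-b - 2)"
    have S: "25 \<le> S" using R by (simp add: S_def)
    have "(C1 + C2) / \<kappa> \<le> sqrt S" by (rule real_le_rsqrt) (use R in \<open>simp add: S_def\<close>)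
    hence sq: "C1 + C2 \<le> \<kappa> * sqrt S" using \<kappa> by (simp add: field_simps)
    have V: "0 \<le> V" by (simp add: V_def)
    have e1: "S powr (p - 1) = V * sqrt S"
      using S by (simp add: V_def p_def powr_half_sqrt[symmetric] powr_add[symmetric])
    have e2: "S powr (p - 2) \<le> V"
      unfolding V_def p_def using S by (intro powr_mono) auto
    have "L x (\<lambda>r. r powr (-b)) \<ge> - (C1 * V)"
      using C1(2)[OF x, of 0] S by (simp add: S_def V_def)
    moreover have "L x (\<lambda>r. r powr p) \<ge> \<kappa> * (V * sqrt S) - C2 * V"
    proof -
      have "C2 * S powr (p - 2) \<le> C2 * V" using e2 C2(1) by (rule mult_left_mono)
      thus ?thesis using C2(2)[OF x, of 0] S
        unfolding e1[symmetric] \<kappa>_def by (simp add: S_def abs_le_iff)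
    qed
    moreover have "(C1 + C2) * V \<le> \<kappa> * sqrt S * V" using sq V by (rule mult_right_mono)
    ultimately show "0 \<le> L x (\<lambda>r. r powr (-b) + r powr (-b - 1/2))"
      unfolding wlap_add p_def[symmetric] by (simp add: algebra_simps)
  qed
qed

lemma radial_nonneg:
  assumes "\<And>r. 0 \<le> r \<Longrightarrow> 0 \<le> \<phi> r"
  shows "0 \<le> radial \<phi> x"
proof (cases "x \<in> A")
  case True
  thus ?thesis using h_pos[OF True] assms[OF s_nonneg[of x]] by (simp add: radial_def)
qed (simp add: radial_def)

text \<open>The supersolution has a strictly positive deficit at y, so a multiple of it dominates
  every truncated potential of a point source at y.\<close>

lemma K_summable: "summable (\<lambda>n. K n x y)"
proof (cases "y \<in> A")
  case True
  obtain c \<kappa> where c: "25 \<le> c" "0 < \<kappa>"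
    and L: "\<And>x. x \<in> A \<Longrightarrow> L x (\<lambda>r. (r + c) powr (-b) - (r + c) powr (-b - 1)) \<le> - \<kappa> * (s x + c) powr (-b - 1 - 1)"
    and \<psi>: "\<And>r. 0 \<le> r \<Longrightarrow> 0 \<le> (r + c) powr (-b) - (r + c) powr (-b - 1)"
    using supersolution[of 1] by auto
  define W where "W = radial (\<lambda>r. (r + c) powr (-b) - (r + c) powr (-b - 1))"
  define a where "a = h y * (\<kappa> * (s y + c) powr (-b - 1 - 1)) / (2 * real d)"
  have "a > 0"
    unfolding a_def using h_pos[OF True] c s_nonneg[of y] d_pos by simp
  have "navg d W x + (if x = y then a else 0) \<le> W x" if "x \<in> A" for x
  proof -
    have "0 \<le> \<kappa> * (s x + c) powr (-b - 1 - 1)" using c by simp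
    hence "L x (\<lambda>r. (r + c) powr (-b) - (r + c) powr (-b - 1)) \<le> 0" using L[OF that] by simp
    hence "h x * L x (\<lambda>r. (r + c) powr (-b) - (r + c) powr (-b - 1)) \<le> 0"
      using h_pos[OF that] by (simp add: mult_nonneg_nonpos)
    moreover have "h y * L y (\<lambda>r. (r + c) powr (-b) - (r + c) powr (-b - 1)) \<le> - a * (2 * real d)"
      using mult_left_mono[OF L[OF True], of "h y"] h_pos[OF True] d_pos by (simp add: a_def)
    ultimately show ?thesis
      unfolding W_def radial_navg[OF that] using d_pos by (auto simp: divide_simps)
  qed
  hence "(\<Sum>y'\<in>{y}. (\<Sum>n<N. K n x y') * (if y' = y then a else 0)) \<le> W x" for N
    using \<open>a > 0\<close> by (intro partial_comparison) (auto simp: W_def intro!: radial_nonneg \<psi>)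
  hence "(\<Sum>n<N. K n x y) \<le> W x / a" for N
    using \<open>a > 0\<close> by (simp add: field_simps)
  thus ?thesis
    by (intro summableI_nonneg_bounded K_nonneg)
next
  case False
  thus ?thesis by (simp add: K_sym[of _ x] K_outside)
qed

sublocale transient_killed_walk d A
  by unfold_locales (rule K_summable)

text \<open>Comparison with a charge at x0 alone, where the deficit of \<open>radial \<psi>\<close>
  is positive. The barrier \<psi> is left abstract so that the bound carries the same shift c as the
  supersolution of the caller.\<close>

lemma G_upper_bound:
  assumes "x0 \<in> A" "0 < \<kappa>" "0 \<le> c"
    and L: "\<And>x. x \<in> A \<Longrightarrow> L x \<psi> \<le> - \<kappa> * (s x + c) powr (-p)"
    and \<psi>: "\<And>r. 0 \<le> r \<Longrightarrow> 0 \<le> \<psi> r" "\<And>r. 0 \<le> r \<Longrightarrow> \<psi> r \<le> (r + c) powr (-b)"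
  obtains M where "0 < M" "\<And>x. x \<in> A \<Longrightarrow> G x x0 \<le> M * (h x * (s x + c) powr (-b))"
proof -
  define f where "f x = (if x \<in> A then h x * (\<kappa> * (s x + c) powr (-p)) / (2 * real d) else 0)" for x
  have f_nonneg: "0 \<le> f x" for x using h_pos[of x] \<open>0 < \<kappa>\<close> by (cases "x \<in> A") (simp_all add: f_def)
  have super: "navg d (radial \<psi>) x + f x \<le> radial \<psi> x" if "x \<in> A" for x
  proof -
    have "h x * L x \<psi> \<le> h x * (- \<kappa> * (s x + c) powr (-p))"
      using h_pos[OF that] L[OF that] by (intro mult_left_mono) auto
    thus ?thesis
      unfolding radial_navg[OF that] f_def using that d_pos by (simp add: divide_simps)
  qed
  have f0: "0 < f x0"
    using assms(1-3) h_pos[OF assms(1)] s_ge_1[OF assms(1)] d_pos by (simp add: f_def)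
  have le: "2 * real d * (\<Sum>y\<in>{x0}. G x y * f y) \<le> radial \<psi> x" for x
    by (intro G_comparison super f_nonneg radial_nonneg \<psi>) auto
  show ?thesis
  proof
    show "0 < 1 / (2 * real d * f x0)" using f0 d_pos by simp
    fix x assume x: "x \<in> A"
    have "G x x0 * (2 * real d * f x0) \<le> radial \<psi> x" using le[of x] by (simp add: mult_ac)
    also have "\<dots> \<le> h x * (s x + c) powr (-b)"
      using x h_pos[OF x] \<psi>(2)[OF s_nonneg] by (simp add: radial_def)
    finally show "G x x0 \<le> 1 / (2 * real d * f x0) * (h x * (s x + c) powr (-b))"
      using f0 d_pos by (simp add: field_simps)
  qed
qed

text \<open>Induction on the l1 distance to x0: moving a differing coordinate towards x0 stays in
  the orthant, and off x0 the value of G is at least a fixed fraction of its value at any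
  neighbour.\<close>

lemma G_pos:
  assumes x0: "x0 \<in> A"
  shows "x \<in> A \<Longrightarrow> 0 < G x x0"
proof (induction "\<Sum>i<d. nat \<bar>x i - x0 i\<bar>" arbitrary: x rule: less_induct)
  case less
  show ?case
  proof (cases "x = x0")
    case True
    have "0 \<le> navg d (\<lambda>z. G z x0) x" by (intro navg_nonneg G_nonneg)
    thus ?thesis using G_equation[OF less.prems, of x0] True d_pos
      by (simp add: add_pos_nonneg)
  next
    case False
    then obtain i where i: "x i \<noteq> x0 i" by auto
    have "i < d"
    proof (rule ccontr)
      assume "\<not> i < d"
      hence "x i = 0" "x0 i = 0" using x0 less.prems by (auto simp: orthantA_def lattice_def)
      thus False using i by simp
    qed
    define z where "z = (if x i < x0 i then x(i := x i + 1) else x(i := x i - 1))"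
    have "z \<in> A"
      using less.prems x0 i \<open>i < d\<close> by (force simp: z_def orthantA_def lattice_def)
    have "(\<Sum>j<d. nat \<bar>z j - x0 j\<bar>) < (\<Sum>j<d. nat \<bar>x j - x0 j\<bar>)"
      using i \<open>i < d\<close> by (intro sum_strict_mono_ex1) (auto simp: z_def intro!: bexI[of _ i])
    hence "0 < G z x0" using \<open>z \<in> A\<close> by (intro less.hyps)
    hence "0 < G z x0 / (2 * real d)" using d_pos by simp
    also have "\<dots> \<le> navg d (\<lambda>z. G z x0) x"
      using \<open>i < d\<close> by (intro navg_ge_neighbour[where i=i] G_nonneg) (auto simp: z_def)
    finally show ?thesis using G_equation[OF less.prems, of x0] False by simp
  qed
qed

lemma finite_A_sublevel: "finite {x \<in> A. s x \<le> \<rho>}"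
  by (rule finite_subset[OF _ finite_sublevel[of d \<rho>]]) (auto simp: orthantA_def)

lemma h_le_powr: assumes "x \<in> A" shows "h x \<le> s x powr (real k / 2)"
proof -
  have s: "0 < s x" using s_ge_1[OF assms] by simp
  have "h x = sqrt ((h x)^2)" using h_pos[OF assms] by simp
  also have "\<dots> \<le> sqrt (s x ^ k)" using h_sq_le[OF assms] by (rule real_sqrt_le_mono)
  also have "\<dots> = s x powr (real k / 2)"
    using s by (simp add: powr_half_sqrt[symmetric] powr_realpow[symmetric] powr_powr)
  finally show ?thesis .
qed

text \<open>Maximum principle for F = radial \<phi> - M G. The sum in M exceeds each single ratio,
  so F <= 0 on the finite set B where \<phi> may fail to be a subsolution; elsewhere F is
  subharmonic, because G is superharmonic.\<close>

lemma G_lower_bound: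
  assumes x0: "x0 \<in> A"
  obtains m where "0 < m" "\<And>x. x \<in> A \<Longrightarrow> m * (h x * s x powr (-b)) \<le> G x x0"
proof -
  define \<phi> where "\<phi> = (\<lambda>r. r powr (-b) + r powr (-b - 1/2))"
  obtain R where R: "\<And>x. x \<in> A \<Longrightarrow> R \<le> s x \<Longrightarrow> 0 \<le> L x \<phi>"
    unfolding \<phi>_def using subsolution by blast
  define B where "B = {x \<in> A. s x \<le> R}"
  have "finite B" unfolding B_def by (rule finite_A_sublevel)
  define M where "M = 1 + (\<Sum>x\<in>B. radial \<phi> x / G x x0)"
  have rad: "0 \<le> radial \<phi> x" for x by (intro radial_nonneg) (simp add: \<phi>_def)
  have M: "1 \<le> M" unfolding M_def by (simp add: sum_nonneg rad G_nonneg)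
  define F where "F x = radial \<phi> x - M * G x x0" for x
  have F: "F x \<le> 0" for x
  proof (rule maximum_principle)
    show "F x \<le> 0" if "x \<notin> A" for x
      using that by (simp add: F_def radial_def G_outside)
    fix x assume x: "x \<in> A" and pos: "0 < F x"
    have "x \<notin> B"
    proof
      assume "x \<in> B"
      hence "radial \<phi> x / G x x0 \<le> (\<Sum>x\<in>B. radial \<phi> x / G x x0)"
        using \<open>finite B\<close> rad G_nonneg by (intro member_le_sum) auto
      hence "radial \<phi> x / G x x0 \<le> M" by (simp add: M_def)
      hence "F x \<le> 0" using G_pos[OF x0 x] by (simp add: F_def field_simps)
      thus False using pos by simp
    qed
    hence "0 \<le> h x * L x \<phi> / (2 * real d)"
      using R[OF x] h_pos[OF x] x by (auto simp: B_def)
    moreover have "navg d (\<lambda>z. G z x0) x \<le> G x x0"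
      using G_equation[OF x, of x0] by simp
    hence "M * navg d (\<lambda>z. G z x0) x \<le> M * G x x0" using M by simp
    ultimately show "F x \<le> navg d F x"
      unfolding F_def navg_diff navg_cmult radial_navg[OF x] by simp
  next
    fix \<epsilon> :: real assume \<epsilon>: "0 < \<epsilon>"
    have "{x. \<epsilon> \<le> F x} \<subseteq> {x \<in> A. s x \<le> 2 / \<epsilon>}"
    proof
      fix x assume "x \<in> {x. \<epsilon> \<le> F x}"
      moreover have "0 \<le> M * G x x0" using M G_nonneg by simp
      ultimately have le: "\<epsilon> \<le> radial \<phi> x" by (simp add: F_def)
      hence x: "x \<in> A" using \<epsilon> by (auto simp: radial_def split: if_splits)
      have s1: "1 \<le> s x" by (rule s_ge_1[OF x])
      have "s x powr (-b - 1/2) \<le> s x powr (-b)" using s1 by (intro powr_mono) auto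
      hence "\<phi> (s x) \<le> 2 * s x powr (-b)" by (simp add: \<phi>_def)
      hence "h x * \<phi> (s x) \<le> s x powr (real k / 2) * (2 * s x powr (-b))"
        using h_le_powr[OF x] h_pos[OF x] by (intro mult_mono) (auto simp: \<phi>_def)
      also have "\<dots> = 2 * s x powr (real k / 2 - b)" by (simp add: powr_add[symmetric])
      \<comment> \<open>Here k/2 - b = 1 - (d + k)/2 <= -1 because d + k >= 4. So the barrier tends
        to 0 and the level sets of F are finite.\<close>
      also have "\<dots> \<le> 2 * s x powr (-1)"
        using s1 d3 k1 by (intro mult_left_mono powr_mono) (auto simp: b_def field_simps)
      finally have "\<epsilon> \<le> 2 / s x" using le x s1 by (simp add: radial_def powr_minus_divide)
      thus "x \<in> {x \<in> A. s x \<le> 2 / \<epsilon>}" using x \<epsilon> s1 by (simp add: field_simps)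
    qed
    thus "finite {x. \<epsilon> \<le> F x}" using finite_A_sublevel finite_subset by blast
  qed
  show ?thesis
  proof
    show "0 < 1 / M" using M by simp
    fix x assume x: "x \<in> A"
    have "h x * s x powr (-b) \<le> radial \<phi> x" using x h_pos[OF x] by (simp add: radial_def \<phi>_def)
    also have "\<dots> \<le> M * G x x0" using F[of x] by (simp add: F_def)
    finally show "1 / M * (h x * s x powr (-b)) \<le> G x x0" using M by (simp add: field_simps)
  qed
qed

end

section \<open>The weighted potential\<close>

text \<open>Turns (i), a sum over an infinite set in the extended nonnegative reals, into real
  bounds for all finite partial sums, the form in which both directions are proved.\<close>

lemma infsum_ennreal_le_iff:
  fixes f :: "'a \<Rightarrow> real"
  assumes "\<And>y. y \<in> A \<Longrightarrow> 0 \<le> f y" "0 \<le> B"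
  shows "(\<Sum>\<^sub>\<infinity>y\<in>A. ennreal (f y)) \<le> ennreal B \<longleftrightarrow> (\<forall>F. finite F \<longrightarrow> F \<subseteq> A \<longrightarrow> sum f F \<le> B)"
proof -
  have "(\<Sum>\<^sub>\<infinity>y\<in>A. ennreal (f y)) = (SUP F\<in>{F. finite F \<and> F \<subseteq> A}. \<Sum>y\<in>F. ennreal (f y))"
    by (rule nonneg_infsum_complete) simp
  moreover have "(\<Sum>y\<in>F. ennreal (f y)) \<le> ennreal B \<longleftrightarrow> sum f F \<le> B" if "F \<subseteq> A" for F
  proof -
    have "(\<Sum>y\<in>F. ennreal (f y)) = ennreal (sum f F)"
      using that assms(1) by (intro sum_ennreal) auto
    thus ?thesis using assms(2) by simp
  qed
  ultimately show ?thesis by (auto simp: SUP_le_iff)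
qed

context orthant
begin

section \<open>Sufficiency of the exponent condition\<close>

lemma weighted_potential_bounded:
  assumes x0: "x0 \<in> A" and q: "1 < q" and \<alpha>: "0 \<le> \<alpha>"
    and exps: "real d + real k < \<alpha> + q * (real d + real k - 2)"
  obtains C where "0 < C" "\<And>x F. x \<in> A \<Longrightarrow> finite F \<Longrightarrow> F \<subseteq> A \<Longrightarrow>
    (\<Sum>y\<in>F. G x y * (enorm d y powr (-\<alpha>) * G x0 y powr q)) \<le> C * G x0 x"
proof -
  \<comment> \<open>Chosen so that -(b + 1 + \<delta>) is the total exponent of T in the bound for
    f: -\<alpha>/2 from the weight, - b q from G^q, and k (q - 1)/2 from estimating h^(q-1). One
    factor h is kept to match \<open>radial \<psi>\<close>. That \<delta> is positive is exactly the
    condition on the exponents.\<close>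
  define \<delta> where "\<delta> = (\<alpha> + q * (real d + real k - 2) + real k) / 2 - (b + 1)"
  have \<delta>: "0 < \<delta>" using exps unfolding \<delta>_def b_def by (simp add: field_simps)
  obtain c \<kappa> where c: "25 \<le> c" and \<kappa>: "0 < \<kappa>"
    and L: "\<And>x. x \<in> A \<Longrightarrow> L x (\<lambda>r. (r + c) powr (-b) - (r + c) powr (-b - \<delta>)) \<le> - \<kappa> * (s x + c) powr (-b - 1 - \<delta>)"
    and \<psi>0: "\<And>r. 0 \<le> r \<Longrightarrow> 0 \<le> (r + c) powr (-b) - (r + c) powr (-b - \<delta>)"
    using supersolution[OF \<delta>] by blast
  define \<psi> where "\<psi> = (\<lambda>r. (r + c) powr (-b) - (r + c) powr (-b - \<delta>))"
  have \<psi>: "0 \<le> \<psi> r" "\<psi> r \<le> (r + c) powr (-b)" if "0 \<le> r" for r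
    using \<psi>0[OF that] by (auto simp: \<psi>_def)
  have L': "L x \<psi> \<le> - \<kappa> * (s x + c) powr (-(b + 1 + \<delta>))" if "x \<in> A" for x
  proof -
    have "-b - 1 - \<delta> = -(b + 1 + \<delta>)" by simp
    thus ?thesis using L[OF that] unfolding \<psi>_def by metis
  qed
  obtain M where M: "0 < M" "\<And>x. x \<in> A \<Longrightarrow> G x x0 \<le> M * (h x * (s x + c) powr (-b))"
    using G_upper_bound[OF x0 \<kappa> _ L' \<psi>] c by auto
  obtain m where m: "0 < m" "\<And>x. x \<in> A \<Longrightarrow> m * (h x * s x powr (-b)) \<le> G x x0"
    using G_lower_bound[OF x0] by blast
  define f where "f y = enorm d y powr (-\<alpha>) * G x0 y powr q" for y
  define E where "E = (1 + c) powr (\<alpha> / 2) * M powr q"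
  have E: "0 < E" using M c by (simp add: E_def)
  have f_le: "f y \<le> E * (h y * (s y + c) powr (-(b + 1 + \<delta>)))" if y: "y \<in> A" for y
  proof -
    define T where "T = s y + c"
    have s1: "1 \<le> s y" by (rule s_ge_1[OF y])
    have T: "0 < T" "s y \<le> T" using s1 c by (auto simp: T_def)
    have hy: "0 < h y" by (rule h_pos[OF y])
    \<comment> \<open>The power -\<alpha>/2 calls for a lower bound on s in terms of T = s + c; as s
      >= 1, this costs only the factor 1 + c.\<close>
    have "c * 1 \<le> c * s y" using c s1 by (intro mult_left_mono) auto
    hence "T \<le> (1 + c) * s y" by (simp add: T_def algebra_simps)
    hence sT: "T / (1 + c) \<le> s y" using c by (simp add: field_simps)
    have "enorm d y powr (-\<alpha>) = s y powr (-\<alpha> / 2)"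
      using s1 by (simp add: enorm_sqn powr_half_sqrt[symmetric] powr_powr)
    also have "\<dots> \<le> (T / (1 + c)) powr (-\<alpha> / 2)"
      using sT T c \<alpha> by (intro powr_mono2') auto
    also have "\<dots> = (1 + c) powr (\<alpha> / 2) * T powr (-\<alpha> / 2)"
      using T c by (simp add: powr_divide powr_minus_divide)
    finally have 1: "enorm d y powr (-\<alpha>) \<le> (1 + c) powr (\<alpha> / 2) * T powr (-\<alpha> / 2)" .
    have "G x0 y powr q \<le> (M * (h y * T powr (-b))) powr q"
      using M(2)[OF y] q G_nonneg by (intro powr_mono2) (auto simp: G_sym[of x0] T_def)
    also have "\<dots> = M powr q * (h y powr q * T powr (-b * q))"
      using M hy T by (simp add: powr_mult powr_powr)
    also have "h y powr q = h y * h y powr (q - 1)"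
      using hy by (simp add: powr_diff)
    finally have 2: "G x0 y powr q \<le> M powr q * (h y * h y powr (q - 1) * T powr (-b * q))" .
    have "h y \<le> T powr (real k / 2)"
      using h_le_powr[OF y] powr_mono2[of "real k / 2" "s y" T] T s1 by simp
    hence "h y powr (q - 1) \<le> (T powr (real k / 2)) powr (q - 1)"
      using hy q by (intro powr_mono2) auto
    hence 3: "h y powr (q - 1) \<le> T powr (real k / 2 * (q - 1))" by (simp add: powr_powr)
    have "f y \<le> ((1 + c) powr (\<alpha> / 2) * T powr (-\<alpha> / 2))
        * (M powr q * (h y * h y powr (q - 1) * T powr (-b * q)))"
      unfolding f_def by (intro mult_mono 1 2) auto
    also have "\<dots> \<le> ((1 + c) powr (\<alpha> / 2) * T powr (-\<alpha> / 2))
        * (M powr q * (h y * T powr (real k / 2 * (q - 1)) * T powr (-b * q)))"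
      using hy by (intro mult_left_mono mult_right_mono 3) auto
    also have "\<dots> = E * (h y * (T powr (-\<alpha> / 2) * T powr (real k / 2 * (q - 1)) * T powr (-b * q)))"
      by (simp add: E_def mult_ac)
    also have "T powr (-\<alpha> / 2) * T powr (real k / 2 * (q - 1)) * T powr (-b * q) = T powr (-(b + 1 + \<delta>))"
      unfolding powr_add[symmetric] by (rule arg_cong) (simp add: \<delta>_def b_def field_simps)
    finally show ?thesis by (simp add: T_def)
  qed
  \<comment> \<open>With this factor the scaled supersolution has deficit constant \<mu> \<kappa> /
    (2 d) = E, matching the bound for f.\<close>
  define \<mu> where "\<mu> = 2 * real d * E / \<kappa>"
  have \<mu>: "0 < \<mu>" using E \<kappa> d_pos by (simp add: \<mu>_def)
  have super: "navg d (\<lambda>z. \<mu> * radial \<psi> z) x + f x \<le> \<mu> * radial \<psi> x" if x: "x \<in> A" for x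
  proof -
    have "\<mu> * (h x * L x \<psi> / (2 * real d)) \<le> \<mu> * (h x * (- \<kappa> * (s x + c) powr (-(b + 1 + \<delta>))) / (2 * real d))"
      using \<mu> h_pos[OF x] L'[OF x] by (intro mult_left_mono divide_right_mono) auto
    also have "\<dots> = - (E * (h x * (s x + c) powr (-(b + 1 + \<delta>))))"
      using \<kappa> d_pos by (simp add: \<mu>_def)
    also have "\<dots> \<le> - f x" using f_le[OF x] by simp
    finally show ?thesis
      unfolding navg_cmult radial_navg[OF x] by (simp add: distrib_left)
  qed
  show ?thesis
  proof
    show "0 < \<mu> / m" using \<mu> m by simp
    fix x F assume x: "x \<in> A" and F: "finite F" "F \<subseteq> A"
    have f_nonneg: "0 \<le> f y" for y by (simp add: f_def)
    have "2 * real d * (\<Sum>y\<in>F. G x y * f y) \<le> \<mu> * radial \<psi> x"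
      using F \<mu> by (intro G_comparison super f_nonneg mult_nonneg_nonneg radial_nonneg \<psi>) auto
    also have "\<dots> \<le> \<mu> * (h x * s x powr (-b))"
    proof -
      have "\<psi> (s x) \<le> (s x + c) powr (-b)" by (intro \<psi> s_nonneg)
      also have "\<dots> \<le> s x powr (-b)"
        using s_ge_1[OF x] c b_pos by (intro powr_mono2') auto
      finally show ?thesis using x \<mu> h_pos[OF x] by (simp add: radial_def)
    qed
    also have "\<dots> \<le> \<mu> / m * G x0 x"
      using mult_left_mono[OF m(2)[OF x], of "\<mu> / m"] \<mu> m(1) by (simp add: G_sym[of x0])
    finally have "2 * real d * (\<Sum>y\<in>F. G x y * f y) \<le> \<mu> / m * G x0 x" .
    moreover have "1 * (\<Sum>y\<in>F. G x y * f y) \<le> 2 * real d * (\<Sum>y\<in>F. G x y * f y)"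
      using d3 by (intro mult_right_mono sum_nonneg mult_nonneg_nonneg G_nonneg f_nonneg) auto
    ultimately show "(\<Sum>y\<in>F. G x y * (enorm d y powr (-\<alpha>) * G x0 y powr q)) \<le> \<mu> / m * G x0 x"
      unfolding f_def[symmetric] by simp
  qed
qed

section \<open>Necessity of the exponent condition\<close>

text \<open>The function h (1 - ((s + c)/\<rho>)^d), cut off at 0, is compared through the maximum
  principle with the potential of an upper bound for its negative Laplacian. The exponent d is large
  enough that later the charge times h T^(-b) is bounded by a multiple of T^(d/2), an increasing
  power, controlled by its value at the edge T = \<rho>.\<close>

lemma cutoff_potential:
  obtains Q where "0 \<le> Q"
    "\<And>(\<rho>::real) y. 0 < \<rho> \<Longrightarrow> 25 \<le> c \<Longrightarrow> y \<in> A \<Longrightarrow>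
      h y * (1 - ((s y + c) / \<rho>) powr real d)
      \<le> (\<Sum>x\<in>{x\<in>A. s x + c \<le> \<rho>}. G y x * (Q * h x * (s x + c) powr (real d - 1) / \<rho> powr real d))"
proof -
  define p where "p = real d"
  obtain C where C: "0 \<le> C" "\<And>c x. x \<in> A \<Longrightarrow> 0 \<le> c \<Longrightarrow> 25 \<le> s x + c \<Longrightarrow>
    \<bar>L x (\<lambda>r. (r + c) powr p)
      - (4 * p * (p + b) * (s x + c) powr (p - 1) - 4 * p * (p - 1) * c * (s x + c) powr (p - 2))\<bar>
      \<le> C * (s x + c) powr (p - 2)"
    using L_powr[of p] by blast
  define Q where "Q = 4 * p * (p + b) + C"
  have p: "3 \<le> p" using d3 by (simp add: p_def)
  have Q: "0 \<le> Q" using p b_pos C(1) by (simp add: Q_def)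
  show ?thesis
  proof
    show "0 \<le> Q" by fact
    fix \<rho> :: real and y assume \<rho>: "0 < \<rho>" and c: "25 \<le> c" and y: "y \<in> A"
    have LQ: "L x (\<lambda>r. (r + c) powr p) \<le> Q * (s x + c) powr (p - 1)" if x: "x \<in> A" for x
    proof -
      have T: "25 \<le> s x + c" using c s_nonneg[of x] by simp
      have "0 \<le> 4 * p * (p - 1) * c * (s x + c) powr (p - 2)" using p c by simp
      moreover have "C * (s x + c) powr (p - 2) \<le> C * (s x + c) powr (p - 1)"
        using C(1) T by (intro mult_left_mono powr_mono) auto
      ultimately show ?thesis
        using C(2)[OF x _ T] c unfolding Q_def distrib_right by linarith
    qed
    define \<eta> where "\<eta> r = 1 + (- 1 / \<rho> powr p) * (r + c) powr p" for r
    define \<zeta> where "\<zeta> = radial (\<lambda>r. max 0 (\<eta> r))"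
    define B where "B = {x\<in>A. s x + c \<le> \<rho>}"
    have "finite B"
      by (rule finite_subset[OF _ finite_A_sublevel[of \<rho>]]) (use c in \<open>auto simp: B_def\<close>)
    define g where "g x = Q * h x * (s x + c) powr (p - 1) / \<rho> powr p" for x
    have g: "0 \<le> g x" if "x \<in> A" for x using Q h_pos[OF that] by (simp add: g_def)
    have \<eta>_eq: "\<eta> (s x) = 1 - ((s x + c) / \<rho>) powr p" for x
      using \<rho> c s_nonneg[of x] by (simp add: \<eta>_def powr_divide)
    have \<eta>_out: "\<eta> (s x) \<le> 0" if "\<rho> < s x + c" for x
    proof -
      have "1 \<le> ((s x + c) / \<rho>) powr p" using that \<rho> p by (intro ge_one_powr_ge_zero) auto
      thus ?thesis by (simp add: \<eta>_eq)
    qed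
    have \<zeta>_out: "\<zeta> x = 0" if "x \<notin> B" for x
      using that \<eta>_out[of x] by (auto simp: \<zeta>_def radial_def B_def)
    have \<zeta>_nonneg: "0 \<le> \<zeta> x" for x unfolding \<zeta>_def by (rule radial_nonneg) simp
    \<comment> \<open>Taking the positive part only raises neighbour averages, so the kink near
      \<rho> does not spoil the inequality on B.\<close>
    have \<eta>_le: "radial \<eta> x \<le> \<zeta> x" for x
      using h_pos[of x] by (cases "x \<in> A") (simp_all add: \<zeta>_def radial_def)
    have \<zeta>_super: "\<zeta> x \<le> navg d \<zeta> x + (if x \<in> B then g x / (2 * real d) else 0)" if x: "x \<in> A" for x
    proof (cases "x \<in> B")
      case True
      have "((s x + c) / \<rho>) powr p \<le> 1"
        using True \<rho> p c s_nonneg[of x] by (intro powr_le1) (auto simp: B_def)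
      hence "\<zeta> x = radial \<eta> x" by (simp add: \<zeta>_def radial_def \<eta>_eq)
      moreover have "L x \<eta> = (- 1 / \<rho> powr p) * L x (\<lambda>r. (r + c) powr p)"
        using wlap_add[of d k x "\<lambda>r. 1" "\<lambda>r. (- 1 / \<rho> powr p) * (r + c) powr p"]
        unfolding wlap_const wlap_cmult \<eta>_def by simp
      hence "h x * L x \<eta> = - (h x * (L x (\<lambda>r. (r + c) powr p) / \<rho> powr p))" by simp
      moreover have "h x * (L x (\<lambda>r. (r + c) powr p) / \<rho> powr p) \<le> h x * (Q * (s x + c) powr (p - 1) / \<rho> powr p)"
        using LQ[OF x] h_pos[OF x] \<rho> by (intro mult_left_mono divide_right_mono) auto
      ultimately have "- g x \<le> h x * L x \<eta>" by (simp add: g_def mult_ac)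
      hence "- g x / (2 * real d) \<le> h x * L x \<eta> / (2 * real d)" by (rule divide_right_mono) simp
      moreover have "navg d (radial \<eta>) x \<le> navg d \<zeta> x" by (intro navg_mono \<eta>_le)
      ultimately show ?thesis
        using \<open>\<zeta> x = radial \<eta> x\<close> True unfolding radial_navg[OF x] by simp
    next
      case False
      thus ?thesis using \<zeta>_out[OF False] navg_nonneg[of \<zeta> d x] \<zeta>_nonneg by simp
    qed
    define F where "F y = \<zeta> y - (\<Sum>x\<in>B. g x * G y x)" for y
    have pot: "0 \<le> (\<Sum>x\<in>B. g x * G y x)" for y
      by (intro sum_nonneg mult_nonneg_nonneg g G_nonneg) (auto simp: B_def)
    have "F y \<le> 0"
    proof (rule maximum_principle)
      show "F x \<le> 0" if "x \<notin> A" for x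
        using pot[of x] \<zeta>_out[of x] that by (auto simp: F_def B_def)
      show "finite {x. \<epsilon> \<le> F x}" if "0 < \<epsilon>" for \<epsilon>
      proof (rule finite_subset[OF _ \<open>finite B\<close>], rule subsetI, rule ccontr)
        fix x assume "x \<in> {x. \<epsilon> \<le> F x}" "x \<notin> B"
        thus False using \<zeta>_out[of x] pot[of x] that by (simp add: F_def)
      qed
      fix x assume x: "x \<in> A"
      have "(\<Sum>y\<in>B. g y * G x y)
          = (\<Sum>y\<in>B. (if x = y then g x / (2 * real d) else 0) + g y * navg d (\<lambda>z. G z y) x)"
        by (intro sum.cong refl, subst G_equation[OF x]) (auto simp: distrib_left)
      also have "\<dots> = (if x \<in> B then g x / (2 * real d) else 0) + navg d (\<lambda>z. \<Sum>y\<in>B. g y * G z y) x"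
        using \<open>finite B\<close> by (simp add: sum.distrib navg_sum navg_cmult)
      finally show "F x \<le> navg d F x"
        unfolding F_def navg_diff using \<zeta>_super[OF x] by simp
    qed
    moreover have "h y * \<eta> (s y) \<le> \<zeta> y"
      using \<eta>_le[of y] y by (simp add: radial_def)
    ultimately have "h y * \<eta> (s y) \<le> (\<Sum>x\<in>B. g x * G y x)" by (simp add: F_def)
    thus "h y * (1 - ((s y + c) / \<rho>) powr real d)
      \<le> (\<Sum>x\<in>{x\<in>A. s x + c \<le> \<rho>}. G y x * (Q * h x * (s x + c) powr (real d - 1) / \<rho> powr real d))"
      unfolding \<eta>_eq B_def[symmetric] g_def p_def by (simp add: mult_ac)
  qed
qed

text \<open>The cutoff at radius R is dominated by the potential of a charge whose total
  mass against the Green function stays bounded in R, because h G is of order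
  r^(2-d).\<close>
lemma harmonic_moment_bounded:
  assumes x0: "x0 \<in> A" and f: "\<And>y. 0 \<le> f y" and C: "0 < C"
    and bound: "\<And>x F. x \<in> A \<Longrightarrow> finite F \<Longrightarrow> F \<subseteq> A \<Longrightarrow> (\<Sum>y\<in>F. G x y * f y) \<le> C * G x0 x"
  obtains D where "\<And>F. finite F \<Longrightarrow> F \<subseteq> A \<Longrightarrow> (\<Sum>y\<in>F. f y * h y) \<le> D"
proof -
  obtain c \<kappa> where c: "25 \<le> c" and \<kappa>: "0 < \<kappa>"
    and L: "\<And>x. x \<in> A \<Longrightarrow> L x (\<lambda>r. (r + c) powr (-b) - (r + c) powr (-b - 1)) \<le> - \<kappa> * (s x + c) powr (-b - 1 - 1)"
    and \<psi>0: "\<And>r. 0 \<le> r \<Longrightarrow> 0 \<le> (r + c) powr (-b) - (r + c) powr (-b - 1)"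
    using supersolution[of 1] by auto
  have L': "L x (\<lambda>r. (r + c) powr (-b) - (r + c) powr (-b - 1)) \<le> - \<kappa> * (s x + c) powr (-(b + 2))"
    if "x \<in> A" for x
  proof -
    have "-b - 1 - 1 = -(b + 2)" by simp
    thus ?thesis using L[OF that] by metis
  qed
  have c0: "0 \<le> c" using c by simp
  obtain M where M: "0 < M" "\<And>x. x \<in> A \<Longrightarrow> G x x0 \<le> M * (h x * (s x + c) powr (-b))"
    using G_upper_bound[OF x0 \<kappa> c0 L' \<psi>0] by auto
  obtain Q where Q: "0 \<le> Q" and cut: "\<And>(\<rho>::real) y. 0 < \<rho> \<Longrightarrow> 25 \<le> c \<Longrightarrow> y \<in> A \<Longrightarrow>
      h y * (1 - ((s y + c) / \<rho>) powr real d)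
      \<le> (\<Sum>x\<in>{x\<in>A. s x + c \<le> \<rho>}. G y x * (Q * h x * (s x + c) powr (real d - 1) / \<rho> powr real d))"
    using cutoff_potential[of c] by blast
  show ?thesis
  proof
    fix F assume F: "finite F" "F \<subseteq> A"
    \<comment> \<open>R is chosen after F, so that (s y + c)/\<rho> <= 1/2 and the cutoff factor is
      at least 1/2 on F; the final bound involves neither F nor R.\<close>
    obtain R0 :: nat where R0: "2 * ((\<Sum>y\<in>F. s y) + c) \<le> real R0" using real_arch_simple by blast
    define R where "R = max 1 R0"
    define \<rho> where "\<rho> = (real R)^2"
    have R: "1 \<le> R" "0 < \<rho>" by (auto simp: R_def \<rho>_def)
    have "2 * ((\<Sum>y\<in>F. s y) + c) \<le> real R * 1" using R0 by (simp add: R_def)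
    also have "\<dots> \<le> \<rho>" unfolding \<rho>_def power2_eq_square using R by (intro mult_left_mono) auto
    finally have \<rho>_ge: "2 * ((\<Sum>y\<in>F. s y) + c) \<le> \<rho>" .
    define B where "B = {x\<in>A. s x + c \<le> \<rho>}"
    define g where "g x = Q * h x * (s x + c) powr (real d - 1) / \<rho> powr real d" for x
    have B_sub: "B \<subseteq> box d (- int R) (int R + 1)"
      using sublevel_subset_box[of \<rho> R d] c by (force simp: B_def \<rho>_def orthantA_def)
    have "card B \<le> (2 * R + 1) ^ d"
      using card_mono[OF finite_box B_sub] by (simp add: card_box nat_add_distrib nat_mult_distrib)
    also have "\<dots> \<le> (3 * R) ^ d" using R by (intro power_mono) auto
    finally have card_B: "real (card B) \<le> 3 ^ d * real R ^ d"
      by (metis of_nat_le_iff of_nat_mult of_nat_numeral of_nat_power power_mult_distrib)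
    have "f y * h y \<le> 2 * (\<Sum>x\<in>B. g x * (G x y * f y))" if "y \<in> F" for y
    proof -
      have y: "y \<in> A" using that F by auto
      have "s y \<le> (\<Sum>y\<in>F. s y)" using that F s_nonneg by (intro member_le_sum) auto
      hence z: "(s y + c) / \<rho> \<le> 1/2" "0 < (s y + c) / \<rho>"
        using \<rho>_ge R c s_nonneg[of y] by (auto simp: field_simps)
      have "((s y + c) / \<rho>) powr real d \<le> ((s y + c) / \<rho>) powr 1"
        by (intro powr_mono') (use z d3 in linarith)+
      also have "\<dots> \<le> 1/2" using z by (simp only: powr_one)
      finally have "h y * (1/2) \<le> h y * (1 - ((s y + c) / \<rho>) powr real d)"
        using h_pos[OF y] by (intro mult_left_mono) auto
      also have "\<dots> \<le> (\<Sum>x\<in>B. G y x * g x)"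
        unfolding B_def g_def by (intro cut R c y)
      finally have "f y * (h y * (1/2)) \<le> f y * (\<Sum>x\<in>B. G y x * g x)" by (rule mult_left_mono) (rule f)
      thus ?thesis by (simp add: sum_distrib_left G_sym[of y] mult_ac)
    qed
    hence "(\<Sum>y\<in>F. f y * h y) \<le> (\<Sum>y\<in>F. 2 * (\<Sum>x\<in>B. g x * (G x y * f y)))" by (rule sum_mono)
    also have "\<dots> = 2 * (\<Sum>x\<in>B. g x * (\<Sum>y\<in>F. G x y * f y))"
      unfolding sum_distrib_left by (subst sum.swap) (simp add: mult_ac)
    \<comment> \<open>Each of the at most (3 R)^d points of B contributes O(R^(-d)): with h^2 <= T^k
      the powers of T combine to T^(d/2) <= \<rho>^(d/2), and \<rho>^(d/2) / \<rho>^d =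
      R^(-d).\<close>
    also have "\<dots> \<le> 2 * (\<Sum>x\<in>B. C * Q * M / real R ^ d)"
    proof (intro mult_left_mono sum_mono)
      fix x assume "x \<in> B"
      hence x: "x \<in> A" and T\<rho>: "s x + c \<le> \<rho>" by (auto simp: B_def)
      define T where "T = s x + c"
      have T: "0 < T" "s x \<le> T" "T \<le> \<rho>" using c s_nonneg[of x] T\<rho> by (auto simp: T_def)
      have "0 \<le> g x" using Q h_pos[OF x] by (simp add: g_def)
      hence "g x * (\<Sum>y\<in>F. G x y * f y) \<le> g x * (C * G x0 x)"
        by (intro mult_left_mono bound x F)
      also have "\<dots> \<le> g x * (C * (M * (h x * T powr (-b))))"
        using M(2)[OF x] C \<open>0 \<le> g x\<close> by (intro mult_left_mono) (auto simp: G_sym[of x0] T_def)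
      also have "\<dots> = C * Q * M * ((h x)^2 * (T powr (real d - 1) * T powr (-b))) / \<rho> powr real d"
        by (simp add: g_def T_def power2_eq_square mult_ac)
      also have "\<dots> \<le> C * Q * M * (T powr real k * (T powr (real d - 1) * T powr (-b))) / \<rho> powr real d"
      proof -
        have "(h x)^2 \<le> T powr real k"
          using h_sq_le[OF x] power_mono[OF T(2) s_nonneg, of k] T by (simp add: powr_realpow)
        thus ?thesis using C Q M by (intro divide_right_mono mult_left_mono mult_right_mono) auto
      qed
      also have "T powr real k * (T powr (real d - 1) * T powr (-b)) = T powr (real d / 2)"
        unfolding powr_add[symmetric] by (rule arg_cong) (simp add: b_def field_simps)
      also have "C * Q * M * T powr (real d / 2) / \<rho> powr real d
          \<le> C * Q * M * \<rho> powr (real d / 2) / \<rho> powr real d"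
        using T C Q M by (intro divide_right_mono mult_left_mono powr_mono2) auto
      also have "\<dots> = C * Q * M / real R ^ d"
      proof -
        have R_powr: "real R powr real d = real R ^ d" using R by (simp add: powr_realpow)
        have \<rho>_powr: "\<rho> = real R powr 2" using R by (simp add: \<rho>_def)
        have "\<rho> powr (real d / 2) = real R ^ d"
          unfolding \<rho>_powr powr_powr using R_powr by simp
        moreover have "\<rho> powr real d = real R ^ d * real R ^ d"
          unfolding \<rho>_powr powr_powr mult_2 powr_add R_powr ..
        ultimately show ?thesis using R by simp
      qed
      finally show "g x * (\<Sum>y\<in>F. G x y * f y) \<le> C * Q * M / real R ^ d" .
    qed simp
    also have "\<dots> = 2 * (real (card B) * (C * Q * M / real R ^ d))" by simp
    also have "\<dots> \<le> 2 * (3 ^ d * real R ^ d * (C * Q * M / real R ^ d))"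
      using card_B C Q M by (intro mult_left_mono mult_right_mono) auto
    also have "\<dots> = 2 * 3 ^ d * (C * Q * M)" using R by simp
    finally show "(\<Sum>y\<in>F. f y * h y) \<le> 2 * 3 ^ d * (C * Q * M)" .
  qed
qed

text \<open>On the cube [n, 2n)^d with n = 2^j all coordinates are comparable to n: h >= n^k, s <= 4
  d n^2, and there are n^d points. If the condition fails, each cube therefore contributes at least
  a fixed \<epsilon> to the sum of f h, and infinitely many disjoint cubes contradict its
  boundedness. The borderline exponent is included, hence the strict inequality.\<close>

lemma exponent_condition:
  assumes x0: "x0 \<in> A" and q: "1 < q" and \<alpha>: "0 \<le> \<alpha>" and C: "0 < C"
    and bound: "\<And>x F. x \<in> A \<Longrightarrow> finite F \<Longrightarrow> F \<subseteq> A \<Longrightarrow>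
      (\<Sum>y\<in>F. G x y * (enorm d y powr (-\<alpha>) * G x0 y powr q)) \<le> C * G x0 x"
  shows "real d + real k < \<alpha> + q * (real d + real k - 2)"
proof (rule ccontr)
  assume "\<not> ?thesis"
  hence neg: "0 \<le> real d + real k - \<alpha> - q * (real d + real k - 2)" by simp
  obtain m where m: "0 < m" "\<And>x. x \<in> A \<Longrightarrow> m * (h x * s x powr (-b)) \<le> G x x0"
    using G_lower_bound[OF x0] by blast
  define f where "f y = enorm d y powr (-\<alpha>) * G x0 y powr q" for y
  obtain D where D: "\<And>F. finite F \<Longrightarrow> F \<subseteq> A \<Longrightarrow> (\<Sum>y\<in>F. f y * h y) \<le> D"
    using harmonic_moment_bounded[OF x0 _ C bound] unfolding f_def by auto
  define a where "a = \<alpha> / 2 + b * q"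
  have a: "0 \<le> a" using \<alpha> b_pos q by (simp add: a_def)
  define \<epsilon> where "\<epsilon> = m powr q * (4 * real d) powr (-a)"
  have \<epsilon>: "0 < \<epsilon>" using m d_pos by (simp add: \<epsilon>_def)
  define P where "P j = box d (2 ^ j) (2 * 2 ^ j)" for j :: nat
  have finite_P: "finite (P j)" for j by (simp add: P_def finite_box)
  have P_sub: "P j \<subseteq> A" for j
  proof
    fix y assume y: "y \<in> P j"
    have "(1::int) \<le> 2 ^ j" by simp
    hence "1 \<le> y i" if "i < k" for i
      using y kd that order_trans[of 1 "2 ^ j" "y i"] by (auto simp: P_def box_def)
    thus "y \<in> A" using y by (auto simp: P_def box_def orthantA_def)
  qed
  have P_sum: "\<epsilon> \<le> (\<Sum>y\<in>P j. f y * h y)" for j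
  proof -
    define n :: real where "n = 2 ^ j"
    have n: "1 \<le> n" by (simp add: n_def)
    \<comment> \<open>Exponent of n in the lower bound for f h: k (q + 1) from h^(q+1), and -2 a
      from s^(-a).\<close>
    define e where "e = real k * (q + 1) - 2 * a"
    have "\<epsilon> * n powr e \<le> f y * h y" if y: "y \<in> P j" for y
    proof -
      have yA: "y \<in> A" using y P_sub by auto
      have yi: "n \<le> y i" "y i \<le> 2 * n" if "i < d" for i
      proof -
        have "2 ^ j \<le> y i" "y i \<le> 2 * 2 ^ j" using y that by (auto simp: P_def box_def)
        hence "real_of_int (2 ^ j) \<le> y i" "real_of_int (y i) \<le> real_of_int (2 * 2 ^ j)"
          by (simp_all only: of_int_le_iff)
        thus "n \<le> y i" "y i \<le> 2 * n" by (simp_all add: n_def)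
      qed
      have s0: "0 < s y" using s_ge_1[OF yA] by simp
      have "(\<Prod>i<k. n) \<le> h y"
        unfolding hprod_def using yi kd n by (intro prod_mono) auto
      hence hn: "n powr real k \<le> h y" using n by (simp add: powr_realpow)
      have "s y \<le> (\<Sum>i<d. (2 * n)^2)"
        unfolding sqn_def by (intro sum_mono power_mono) (use yi n in force)+
      hence sn: "s y \<le> 4 * real d * n^2" by (simp add: power_mult_distrib)
      have "(m * (h y * s y powr (-b))) powr q \<le> G x0 y powr q"
        using m h_pos[OF yA] q by (intro powr_mono2) (auto simp: G_sym[of x0] yA)
      moreover have "(m * (h y * s y powr (-b))) powr q = m powr q * (h y powr q * s y powr (-b * q))"
        using m h_pos[OF yA] by (simp add: powr_mult powr_powr)
      moreover have "enorm d y powr (-\<alpha>) = s y powr (-\<alpha> / 2)"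
        using s0 by (simp add: enorm_sqn powr_half_sqrt[symmetric] powr_powr)
      ultimately have "s y powr (-\<alpha> / 2) * (m powr q * (h y powr q * s y powr (-b * q))) * h y \<le> f y * h y"
        unfolding f_def using h_pos[OF yA] by (intro mult_right_mono mult_mono) auto
      also have "s y powr (-\<alpha> / 2) * (m powr q * (h y powr q * s y powr (-b * q))) * h y
          = m powr q * (h y powr (q + 1) * (s y powr (-\<alpha> / 2) * s y powr (-b * q)))"
        using h_pos[OF yA] by (simp add: powr_add mult_ac)
      also have "s y powr (-\<alpha> / 2) * s y powr (-b * q) = s y powr (-a)"
        unfolding powr_add[symmetric] by (rule arg_cong) (simp add: a_def)
      finally have "m powr q * (h y powr (q + 1) * s y powr (-a)) \<le> f y * h y" .
      moreover have "m powr q * ((n powr real k) powr (q + 1) * (4 * real d * n^2) powr (-a))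
          \<le> m powr q * (h y powr (q + 1) * s y powr (-a))"
        using hn sn a q s0 by (intro mult_left_mono mult_mono powr_mono2 powr_mono2') auto
      moreover have "m powr q * ((n powr real k) powr (q + 1) * (4 * real d * n^2) powr (-a)) = \<epsilon> * n powr e"
      proof -
        have "(4 * real d * n^2) powr (-a) = (4 * real d) powr (-a) * n powr (-2 * a)"
          using n powr_powr[of n 2 "-a"] by (simp add: powr_mult)
        moreover have "n powr e = (n powr real k) powr (q + 1) * n powr (-2 * a)"
          unfolding powr_powr powr_add[symmetric] e_def by simp
        ultimately show ?thesis by (simp add: \<epsilon>_def mult_ac)
      qed
      ultimately show ?thesis by simp
    qed
    hence "(\<Sum>y\<in>P j. \<epsilon> * n powr e) \<le> (\<Sum>y\<in>P j. f y * h y)" by (rule sum_mono)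
    moreover have "real (card (P j)) = n powr real d"
      using n by (simp add: P_def card_box n_def powr_realpow nat_power_eq)
    hence "(\<Sum>y\<in>P j. \<epsilon> * n powr e) = \<epsilon> * n powr (real d + e)"
      by (simp add: powr_add)
    \<comment> \<open>Here d + e = d + k - \<alpha> - q (d + k - 2), which is nonnegative by the
      negated claim.\<close>
    moreover have "1 \<le> n powr (real d + e)"
      using n neg by (intro ge_one_powr_ge_zero) (auto simp: e_def a_def b_def field_simps)
    hence "\<epsilon> * 1 \<le> \<epsilon> * n powr (real d + e)" using \<epsilon> by (intro mult_left_mono) auto
    ultimately show ?thesis by linarith
  qed
  have disj_less: "P i \<inter> P j = {}" if "i < j" for i j
  proof -
    have "(2::int) * 2 ^ i \<le> 2 ^ j" using power_increasing[of "Suc i" j "2::int"] that by simp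
    thus ?thesis using d_pos by (force simp: P_def box_def)
  qed
  have disj: "P i \<inter> P j = {}" if "i \<noteq> j" for i j
    using disj_less[of i j] disj_less[of j i] that by (cases "i < j") auto
  have "real J * \<epsilon> \<le> D" for J :: nat
  proof -
    have "real J * \<epsilon> = (\<Sum>j<J. \<epsilon>)" by simp
    also have "\<dots> \<le> (\<Sum>j<J. \<Sum>y\<in>P j. f y * h y)" by (intro sum_mono P_sum)
    also have "\<dots> = (\<Sum>y\<in>(\<Union>j<J. P j). f y * h y)"
      by (rule sum.UNION_disjoint[symmetric]) (simp_all add: disj finite_P)
    also have "\<dots> \<le> D"
      using P_sub by (intro D) (auto simp: finite_P)
    finally show ?thesis .
  qed
  moreover obtain J :: nat where "D / \<epsilon> < real J" using reals_Archimedean2 by blast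
  ultimately show False using \<epsilon> by (auto simp: field_simps not_less[symmetric])
qed

end

theorem theorem8p5:
  fixes d k :: nat and x0 :: "nat \<Rightarrow> int" and q \<alpha> :: real
  assumes "d \<ge> 3" and "1 \<le> k" and "k \<le> d"
    and "x0 \<in> orthantA d k" and "q > 1" and "\<alpha> \<ge> 0"
  shows "(\<exists>C>0. \<forall>x\<in>orthantA d k.
            (\<Sum>\<^sub>\<infinity>y\<in>orthantA d k.
               ennreal (greenA d (orthantA d k) x y * enorm d y powr (-\<alpha>)
                        * greenA d (orthantA d k) x0 y powr q))
            \<le> ennreal (C * greenA d (orthantA d k) x0 x))
         \<longleftrightarrow> \<alpha> + q * (real d + real k - 2) > real d + real k"
proof -
  interpret orthant d k by unfold_locales fact+
  have iff: "(\<Sum>\<^sub>\<infinity>y\<in>A. ennreal (G x y * enorm d y powr (-\<alpha>) * G x0 y powr q)) \<le> ennreal (C * G x0 x)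
    \<longleftrightarrow> (\<forall>F. finite F \<longrightarrow> F \<subseteq> A \<longrightarrow>
          (\<Sum>y\<in>F. G x y * (enorm d y powr (-\<alpha>) * G x0 y powr q)) \<le> C * G x0 x)" if "0 < C" for C x
    unfolding mult.assoc
    by (rule infsum_ennreal_le_iff) (use that G_nonneg in simp_all)
  show ?thesis
  proof
    assume "\<alpha> + q * (real d + real k - 2) > real d + real k"
    with assms obtain C where "0 < C" "\<And>x F. x \<in> A \<Longrightarrow> finite F \<Longrightarrow> F \<subseteq> A \<Longrightarrow>
      (\<Sum>y\<in>F. G x y * (enorm d y powr (-\<alpha>) * G x0 y powr q)) \<le> C * G x0 x"
      using weighted_potential_bounded[of x0 q \<alpha>] by blast
    thus "\<exists>C>0. \<forall>x\<in>A. (\<Sum>\<^sub>\<infinity>y\<in>A. ennreal (G x y * enorm d y powr (-\<alpha>) * G x0 y powr q))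
        \<le> ennreal (C * G x0 x)"
      by (intro exI[of _ C]) (simp add: iff)
  next
    assume "\<exists>C>0. \<forall>x\<in>A. (\<Sum>\<^sub>\<infinity>y\<in>A. ennreal (G x y * enorm d y powr (-\<alpha>) * G x0 y powr q))
        \<le> ennreal (C * G x0 x)"
    then obtain C where C: "0 < C" "\<forall>x\<in>A. (\<Sum>\<^sub>\<infinity>y\<in>A. ennreal (G x y * enorm d y powr (-\<alpha>) * G x0 y powr q))
        \<le> ennreal (C * G x0 x)"
      by (elim exE conjE)
    show "\<alpha> + q * (real d + real k - 2) > real d + real k"
    proof (rule exponent_condition[OF assms(4-6) C(1)])
      fix x F assume "x \<in> A" "finite F" "F \<subseteq> A"
      thus "(\<Sum>y\<in>F. G x y * (enorm d y powr (-\<alpha>) * G x0 y powr q)) \<le> C * G x0 x"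
        using C(2) unfolding iff[OF C(1)] by simp
    qed
  qed
qed

end
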